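(* Let $0<\epsilon<1/3$, let $L_1$ be a superintuitionistic logic and $L_2$ a consistent normal modal logic. Let $\{(C_n(\bar p,\bar q),D_n(\bar p,\bar q))\}_n$ be a sequence of pairs of monotone circuits (resp. monotone $\mathcal{L}_\Box$-circuits) computing an $L_1$-PDI of $\bigwedge_i(p_i\vee q_i)\to\neg\mathrm{Clique}^\epsilon_n(\neg\bar p,\bar r)\vee\neg\mathrm{Color}^\epsilon_n(\bar q,\bar s)$ (resp. an $L_2$-MDI of $\bigwedge_i(\Box p_i\vee\Box q_i)\to\Box\neg\mathrm{Clique}^\epsilon_n(\neg\bar p,\bar r)\vee\Box\neg\mathrm{Color}^\epsilon_n(\bar q,\bar s)$) for every $n$. Then the size of $D_n$ is at least $2^{\Omega(n^{1/3-\epsilon})}$.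
   Context: Let $k=\lfloor n^{2/3}\rfloor$, $l=\lfloor n^{2/3-2\epsilon}\rfloor$. For a tuple of graph atoms $\bar x=(x_{ij})$ indexed by two-element sets $\{i,j\}\subseteq\{1,\dots,n\}$ and atoms $r_{ui}$ ($u\le k$, $i\le n$), $\mathrm{Clique}^\epsilon_n(\bar x,\bar r)$ is the conjunction of: $\bigvee_{i\le n}r_{ui}$ ($u\le k$); $\neg r_{ui_1}\vee\neg r_{ui_2}$ ($i_1\neq i_2$); $\neg r_{u_1i}\vee\neg r_{u_2i}$ ($u_1\ne u_2$); $\neg r_{u_1i_1}\vee\neg r_{u_2i_2}\vee x_{i_1i_2}$ ($u_1\ne u_2$, $\{i_1,i_2\}$ two-element). For atoms $s_{ia}$ ($i\le n$, $a\le l$), $\mathrm{Color}^\epsilon_n(\bar x,\bar s)$ is the conjunction of: $\bigvee_{a\le l}s_{ia}$ ($i\le n$); $\neg s_{ia_1}\vee\neg s_{ia_2}$ ($a_1\ne a_2$); $\neg s_{i_1a}\vee\neg s_{i_2a}\vee\neg x_{i_1i_2}$ ($a\le l$, $\{i_1,i_2\}$ two-element). $\bar p$, $\bar q$ are tuples of such graph atoms; $\neg\bar p$ denotes substituting $\neg p_{ij}$ for $x_{ij}$. $\neg\chi:=\chi\to\bot$. Monotone circuits use only gates $\top,\bot,\wedge,\vee$ (and, for $\mathcal{L}_\Box$-circuits, also $\Box$); $[C]$ is the unfolded formula of circuit $C$. An $L$-PDI for $(\phi\to\psi\vee\theta)\in L$ is a pair $(I,J)$ with atoms among those of $\phi$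 such that $\phi\to I\vee J$, $I\to\psi$, $J\to\theta$ are in $L$; an $L$-MDI for $(\phi\to\Box\psi\vee\Box\theta)\in L$ is analogous with $I\to\Box\psi$, $J\to\Box\theta$. The pair $(C_n,D_n)$ computes an $L$-PDI/MDI if $([C_n],[D_n])$ is one.
   Formalization: L_1 is assumed consistent and L_2 is assumed not to contain □⊥ (excluding only Ver = K+□⊥), since in these logics (⊤,⊥) is an interpolant with D_n of size 1; "for every n" is relaxed to all n ≥ n_0, because for n = 1 no interpolant exists. *)

theory Defs
  imports Complex_Main
begin

text \<open>
  The countably infinite supply of atoms contains the four tuples of the statement.
  A graph atom carries its two-element index set as an increasing pair; see \<open>pv\<close>, \<open>qv\<close>.
\<close>

datatype atom = P nat nat | Q nat nat | R nat nat | S nat nat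

datatype form =
  Atom atom | Bot | Top | And form form | Or form form | Imp form form

datatype mform =
  MAtom atom | MBot | MTop | MAnd mform mform | MOr mform mform | MImp mform mform | Box mform

abbreviation Neg :: "form \<Rightarrow> form" where "Neg A \<equiv> Imp A Bot"

fun bigand :: "form list \<Rightarrow> form" where
  "bigand [] = Top"
| "bigand (A # As) = And A (bigand As)"

fun bigor :: "form list \<Rightarrow> form" where
  "bigor [] = Bot"
| "bigor (A # As) = Or A (bigor As)"

fun mbigand :: "mform list \<Rightarrow> mform" where
  "mbigand [] = MTop"
| "mbigand (A # As) = MAnd A (mbigand As)"

fun atoms :: "form \<Rightarrow> atom set" where
  "atoms (Atom a) = {a}"
| "atoms Bot = {}"
| "atoms Top = {}"
| "atoms (And A B) = atoms A \<union> atoms B"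
| "atoms (Or A B) = atoms A \<union> atoms B"
| "atoms (Imp A B) = atoms A \<union> atoms B"

fun matoms :: "mform \<Rightarrow> atom set" where
  "matoms (MAtom a) = {a}"
| "matoms MBot = {}"
| "matoms MTop = {}"
| "matoms (MAnd A B) = matoms A \<union> matoms B"
| "matoms (MOr A B) = matoms A \<union> matoms B"
| "matoms (MImp A B) = matoms A \<union> matoms B"
| "matoms (Box A) = matoms A"

fun subst :: "(atom \<Rightarrow> form) \<Rightarrow> form \<Rightarrow> form" where
  "subst \<sigma> (Atom a) = \<sigma> a"
| "subst \<sigma> Bot = Bot"
| "subst \<sigma> Top = Top"
| "subst \<sigma> (And A B) = And (subst \<sigma> A) (subst \<sigma> B)"
| "subst \<sigma> (Or A B) = Or (subst \<sigma> A) (subst \<sigma> B)"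
| "subst \<sigma> (Imp A B) = Imp (subst \<sigma> A) (subst \<sigma> B)"

fun msubst :: "(atom \<Rightarrow> mform) \<Rightarrow> mform \<Rightarrow> mform" where
  "msubst \<sigma> (MAtom a) = \<sigma> a"
| "msubst \<sigma> MBot = MBot"
| "msubst \<sigma> MTop = MTop"
| "msubst \<sigma> (MAnd A B) = MAnd (msubst \<sigma> A) (msubst \<sigma> B)"
| "msubst \<sigma> (MOr A B) = MOr (msubst \<sigma> A) (msubst \<sigma> B)"
| "msubst \<sigma> (MImp A B) = MImp (msubst \<sigma> A) (msubst \<sigma> B)"
| "msubst \<sigma> (Box A) = Box (msubst \<sigma> A)"

text \<open>The inclusion of the propositional language into the modal one.\<close>

fun emb :: "form \<Rightarrow> mform" where
  "emb (Atom a) = MAtom a"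
| "emb Bot = MBot"
| "emb Top = MTop"
| "emb (And A B) = MAnd (emb A) (emb B)"
| "emb (Or A B) = MOr (emb A) (emb B)"
| "emb (Imp A B) = MImp (emb A) (emb B)"

inductive ipc :: "form \<Rightarrow> bool" where
  "ipc (Imp A (Imp B A))"
| "ipc (Imp (Imp A (Imp B C)) (Imp (Imp A B) (Imp A C)))"
| "ipc (Imp (And A B) A)"
| "ipc (Imp (And A B) B)"
| "ipc (Imp A (Imp B (And A B)))"
| "ipc (Imp A (Or A B))"
| "ipc (Imp B (Or A B))"
| "ipc (Imp (Imp A C) (Imp (Imp B C) (Imp (Or A B) C)))"
| "ipc (Imp Bot A)"
| "ipc Top"
| "ipc (Imp A B) \<Longrightarrow> ipc A \<Longrightarrow> ipc B"

definition superintuitionistic :: "form set \<Rightarrow> bool" where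
  "superintuitionistic L \<longleftrightarrow>
     (\<forall>A. ipc A \<longrightarrow> A \<in> L) \<and>
     (\<forall>A B. Imp A B \<in> L \<longrightarrow> A \<in> L \<longrightarrow> B \<in> L) \<and>
     (\<forall>\<sigma> A. A \<in> L \<longrightarrow> subst \<sigma> A \<in> L)"

fun eval :: "(atom \<Rightarrow> bool) \<Rightarrow> form \<Rightarrow> bool" where
  "eval v (Atom a) = v a"
| "eval v Bot = False"
| "eval v Top = True"
| "eval v (And A B) = (eval v A \<and> eval v B)"
| "eval v (Or A B) = (eval v A \<or> eval v B)"
| "eval v (Imp A B) = (eval v A \<longrightarrow> eval v B)"

definition normal_modal :: "mform set \<Rightarrow> bool" where
  "normal_modal L \<longleftrightarrow>
     (\<forall>A. (\<forall>v. eval v A) \<longrightarrow> emb A \<in> L) \<and>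
     (\<forall>A B. MImp (Box (MImp A B)) (MImp (Box A) (Box B)) \<in> L) \<and>
     (\<forall>A B. MImp A B \<in> L \<longrightarrow> A \<in> L \<longrightarrow> B \<in> L) \<and>
     (\<forall>A. A \<in> L \<longrightarrow> Box A \<in> L) \<and>
     (\<forall>\<sigma> A. A \<in> L \<longrightarrow> msubst \<sigma> A \<in> L)"

text \<open>
  A circuit is the list of its nodes in topological order; a node refers to its inputs by their
  positions, and the last node is the output. The size is the number of nodes.
\<close>

datatype gate = In atom | GTop | GBot | GAnd nat nat | GOr nat nat

datatype mgate = MIn atom | MGTop | MGBot | MGAnd nat nat | MGOr nat nat | MGBox nat

fun gate_inputs :: "gate \<Rightarrow> nat set" where
  "gate_inputs (GAnd i j) = {i, j}"
| "gate_inputs (GOr i j) = {i, j}"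
| "gate_inputs _ = {}"

fun mgate_inputs :: "mgate \<Rightarrow> nat set" where
  "mgate_inputs (MGAnd i j) = {i, j}"
| "mgate_inputs (MGOr i j) = {i, j}"
| "mgate_inputs (MGBox i) = {i}"
| "mgate_inputs _ = {}"

definition monotone_circuit :: "gate list \<Rightarrow> bool" where
  "monotone_circuit C \<longleftrightarrow> C \<noteq> [] \<and> (\<forall>m < length C. gate_inputs (C ! m) \<subseteq> {..<m})"

definition monotone_mcircuit :: "mgate list \<Rightarrow> bool" where
  "monotone_mcircuit C \<longleftrightarrow> C \<noteq> [] \<and> (\<forall>m < length C. mgate_inputs (C ! m) \<subseteq> {..<m})"

fun gate_form :: "form list \<Rightarrow> gate \<Rightarrow> form" where
  "gate_form As (In a) = Atom a"
| "gate_form As GTop = Top"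
| "gate_form As GBot = Bot"
| "gate_form As (GAnd i j) = And (As ! i) (As ! j)"
| "gate_form As (GOr i j) = Or (As ! i) (As ! j)"

fun mgate_form :: "mform list \<Rightarrow> mgate \<Rightarrow> mform" where
  "mgate_form As (MIn a) = MAtom a"
| "mgate_form As MGTop = MTop"
| "mgate_form As MGBot = MBot"
| "mgate_form As (MGAnd i j) = MAnd (As ! i) (As ! j)"
| "mgate_form As (MGOr i j) = MOr (As ! i) (As ! j)"
| "mgate_form As (MGBox i) = Box (As ! i)"

definition unfold_circuit :: "gate list \<Rightarrow> form" where
  "unfold_circuit C = last (foldl (\<lambda>As g. As @ [gate_form As g]) [] C)"

definition unfold_mcircuit :: "mgate list \<Rightarrow> mform" where
  "unfold_mcircuit C = last (foldl (\<lambda>As g. As @ [mgate_form As g]) [] C)"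

definition circuit_size :: "'g list \<Rightarrow> nat" where
  "circuit_size C = length C"

definition is_PDI :: "form set \<Rightarrow> form \<Rightarrow> form \<Rightarrow> form \<Rightarrow> form \<times> form \<Rightarrow> bool" where
  "is_PDI L \<phi> \<psi> \<theta> = (\<lambda>(I, J).
     Imp \<phi> (Or \<psi> \<theta>) \<in> L \<and>
     atoms I \<subseteq> atoms \<phi> \<and> atoms J \<subseteq> atoms \<phi> \<and>
     Imp \<phi> (Or I J) \<in> L \<and> Imp I \<psi> \<in> L \<and> Imp J \<theta> \<in> L)"

text \<open>Here \<open>\<psi>\<close> and \<open>\<theta>\<close> are given without their boxes.\<close>

definition is_MDI :: "mform set \<Rightarrow> mform \<Rightarrow> mform \<Rightarrow> mform \<Rightarrow> mform \<times> mform \<Rightarrow> bool" where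
  "is_MDI L \<phi> \<psi> \<theta> = (\<lambda>(I, J).
     MImp \<phi> (MOr (Box \<psi>) (Box \<theta>)) \<in> L \<and>
     matoms I \<subseteq> matoms \<phi> \<and> matoms J \<subseteq> matoms \<phi> \<and>
     MImp \<phi> (MOr I J) \<in> L \<and> MImp I (Box \<psi>) \<in> L \<and> MImp J (Box \<theta>) \<in> L)"

definition clique_num :: "nat \<Rightarrow> nat" where
  "clique_num n = nat \<lfloor>real n powr (2/3)\<rfloor>"

definition color_num :: "real \<Rightarrow> nat \<Rightarrow> nat" where
  "color_num \<epsilon> n = nat \<lfloor>real n powr (2/3 - 2 * \<epsilon>)\<rfloor>"

text \<open>
  In \<open>Clique\<close> and \<open>Color\<close> the tuple \<open>x\<close> is a symmetric function of its two indices;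
  only its values at distinct indices are used.
\<close>

definition pv :: "nat \<Rightarrow> nat \<Rightarrow> atom" where "pv i j = P (min i j) (max i j)"

definition qv :: "nat \<Rightarrow> nat \<Rightarrow> atom" where "qv i j = Q (min i j) (max i j)"

definition Clique :: "nat \<Rightarrow> (nat \<Rightarrow> nat \<Rightarrow> form) \<Rightarrow> (nat \<Rightarrow> nat \<Rightarrow> form) \<Rightarrow> form" where
  "Clique n x r = (let V = [1..<n + 1]; K = [1..<clique_num n + 1] in bigand (
       [bigor [r u i. i \<leftarrow> V]. u \<leftarrow> K]
     @ [Or (Neg (r u i1)) (Neg (r u i2)). u \<leftarrow> K, i1 \<leftarrow> V, i2 \<leftarrow> V, i1 \<noteq> i2]
     @ [Or (Neg (r u1 i)) (Neg (r u2 i)). u1 \<leftarrow> K, u2 \<leftarrow> K, u1 \<noteq> u2, i \<leftarrow> V]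
     @ [Or (Or (Neg (r u1 i1)) (Neg (r u2 i2))) (x i1 i2).
          u1 \<leftarrow> K, u2 \<leftarrow> K, u1 \<noteq> u2, i1 \<leftarrow> V, i2 \<leftarrow> V, i1 \<noteq> i2]))"

definition Color :: "real \<Rightarrow> nat \<Rightarrow> (nat \<Rightarrow> nat \<Rightarrow> form) \<Rightarrow> (nat \<Rightarrow> nat \<Rightarrow> form) \<Rightarrow> form" where
  "Color \<epsilon> n x s = (let V = [1..<n + 1]; A = [1..<color_num \<epsilon> n + 1] in bigand (
       [bigor [s i a. a \<leftarrow> A]. i \<leftarrow> V]
     @ [Or (Neg (s i a1)) (Neg (s i a2)). i \<leftarrow> V, a1 \<leftarrow> A, a2 \<leftarrow> A, a1 \<noteq> a2]
     @ [Or (Or (Neg (s i1 a)) (Neg (s i2 a))) (Neg (x i1 i2)).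
          a \<leftarrow> A, i1 \<leftarrow> V, i2 \<leftarrow> V, i1 \<noteq> i2]))"

definition edges :: "nat \<Rightarrow> (nat \<times> nat) list" where
  "edges n = [(i, j). i \<leftarrow> [1..<n + 1], j \<leftarrow> [1..<n + 1], i < j]"

definition premise :: "nat \<Rightarrow> form" where
  "premise n = bigand [Or (Atom (pv i j)) (Atom (qv i j)). (i, j) \<leftarrow> edges n]"

definition mpremise :: "nat \<Rightarrow> mform" where
  "mpremise n = mbigand [MOr (Box (MAtom (pv i j))) (Box (MAtom (qv i j))). (i, j) \<leftarrow> edges n]"

definition not_clique :: "nat \<Rightarrow> form" where
  "not_clique n = Neg (Clique n (\<lambda>i j. Neg (Atom (pv i j))) (\<lambda>u i. Atom (R u i)))"

definition not_color :: "real \<Rightarrow> nat \<Rightarrow> form" where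
  "not_color \<epsilon> n = Neg (Color \<epsilon> n (\<lambda>i j. Atom (qv i j)) (\<lambda>i a. Atom (S i a)))"

definition computes_PDI :: "form set \<Rightarrow> real \<Rightarrow> nat \<Rightarrow> gate list \<Rightarrow> gate list \<Rightarrow> bool" where
  "computes_PDI L \<epsilon> n C D \<longleftrightarrow>
     monotone_circuit C \<and> monotone_circuit D \<and>
     is_PDI L (premise n) (not_clique n) (not_color \<epsilon> n) (unfold_circuit C, unfold_circuit D)"

definition computes_MDI :: "mform set \<Rightarrow> real \<Rightarrow> nat \<Rightarrow> mgate list \<Rightarrow> mgate list \<Rightarrow> bool" where
  "computes_MDI L \<epsilon> n C D \<longleftrightarrow>
     monotone_mcircuit C \<and> monotone_mcircuit D \<and>
     is_MDI L (mpremise n) (emb (not_clique n)) (emb (not_color \<epsilon> n))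
       (unfold_mcircuit C, unfold_mcircuit D)"

text \<open>
  The lower bound fails for the logic of a single irreflexive point, the only consistent normal
  modal logic that contains \<open>Box MBot\<close>: there every boxed formula is a theorem, and the constant
  pair (top, bottom) is an interpolant.
\<close>

fun ver_eval :: "(atom \<Rightarrow> bool) \<Rightarrow> mform \<Rightarrow> bool" where
  "ver_eval v (MAtom a) = v a"
| "ver_eval v MBot = False"
| "ver_eval v MTop = True"
| "ver_eval v (MAnd A B) = (ver_eval v A \<and> ver_eval v B)"
| "ver_eval v (MOr A B) = (ver_eval v A \<or> ver_eval v B)"
| "ver_eval v (MImp A B) = (ver_eval v A \<longrightarrow> ver_eval v B)"
| "ver_eval v (Box A) = True"

lemma ver_eval_emb: "ver_eval v (emb A) = eval v A"
  by (induction A) auto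

lemma ver_eval_msubst: "ver_eval v (msubst \<sigma> A) = ver_eval (\<lambda>a. ver_eval v (\<sigma> a)) A"
  by (induction A) auto

lemma verum_constant_MDI:
  defines "Ver \<equiv> {A. \<forall>v. ver_eval v A}"
  shows "normal_modal Ver" and "MBot \<notin> Ver" and "Box MBot \<in> Ver"
    and "computes_MDI Ver \<epsilon> n [MGTop] [MGBot]"
  by (auto simp: Ver_def normal_modal_def ver_eval_emb ver_eval_msubst computes_MDI_def is_MDI_def
      monotone_mcircuit_def unfold_mcircuit_def)

end

theory Submission
  imports Defs "HOL-Library.FuncSet" "HOL-Real_Asymp.Real_Asymp"
begin

text \<open>
  Under the substitutions of \<open>\<top>\<close> and \<open>\<bottom>\<close> for atoms, a consistent superintuitionistic logic is sound for
  classical truth. Evaluating the interpolant \<open>J\<close> of \<open>D\<^sub>n\<close> at \<open>p = \<not> x\<close>, \<open>q = x\<close> shows that it accepts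
  all \<open>k\<close>-cliques \<open>x\<close>, and since \<open>J \<rightarrow> \<not> Color(q, s)\<close> does not mention \<open>p\<close>, it rejects \<open>l\<close>-colourable
  \<open>q\<close> for every \<open>p\<close>. As \<open>J\<close> is monotone, setting \<open>p = \<top>\<close> preserves both, and leaves a monotone circuit
  that separates \<open>k\<close>-cliques from complete \<open>l\<close>-partite graphs. In the modal case, whether a variable-free
  positive formula lies strictly above \<open>\<box>\<bottom>\<close> is computed by a monotone circuit of at most twice the size.

  The lower bound for such circuits is Alon and Boppana's form of Razborov's approximation method. A gate
  is approximated by a family of vertex sets of size at most \<open>r \<approx> \<surd>(l/2)\<close>, which accepts a graph if one
  of the sets is a clique in it, and which is closed under adding \<open>W\<close> whenever it contains \<open>p\<close> sets whose
  pairwise intersections lie in \<open>W\<close>. Closing after a disjunction costs a fraction \<open>(n+1)\<^sup>r / 2\<^sup>p\<close> of the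
  colourings. A closed family has at most \<open>(p - 1)\<^sup>i\<close> minimal sets of size \<open>i\<close>, hence intersecting two
  families for a conjunction loses only a fraction \<open>4 / 2\<^bsup>r/2\<^esup>\<close> of the cliques if \<open>2 p k \<le> n\<close>.
  Taking \<open>p \<approx> n / 2 k \<approx> n\<^bsup>1/3\<^esup> / 2\<close> makes both losses exponentially small in \<open>r \<approx> n\<^bsup>1/3-\<epsilon>\<^esup>\<close>.
\<close>

section \<open>Counting lemmas\<close>

text \<open>The binomial theorem indexed by subsets instead of sizes. In
  \<open>weak_sunflower\<close> it adds up the bounds for all traces on a fixed set.\<close>

lemma sum_Pow_power_card_diff:
  fixes x :: "'a::comm_semiring_1"
  assumes "finite D"
  shows "(\<Sum>C\<in>Pow D. x ^ (card D - card C)) = (x + 1) ^ card D"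
  using assms
proof (induction D)
  case (insert d D)
  have inj: "inj_on (insert d) (Pow D)"
    using insert.hyps by (auto simp: inj_on_def)
  have "(\<Sum>C\<in>Pow (insert d D). x ^ (card (insert d D) - card C)) =
      (\<Sum>C\<in>Pow D. x ^ (Suc (card D) - card C)) + (\<Sum>C\<in>insert d ` Pow D. x ^ (Suc (card D) - card C))"
    unfolding Pow_insert using insert.hyps by (subst sum.union_disjoint) auto
  also have "(\<Sum>C\<in>insert d ` Pow D. x ^ (Suc (card D) - card C)) = (\<Sum>C\<in>Pow D. x ^ (card D - card C))"
    unfolding sum.reindex[OF inj] o_def
  proof (intro sum.cong refl)
    fix C assume "C \<in> Pow D"
    then have "finite C" "d \<notin> C" using insert.hyps by (auto intro: finite_subset)
    then show "x ^ (Suc (card D) - card (insert d C)) = x ^ (card D - card C)" by simp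
  qed
  also have "(\<Sum>C\<in>Pow D. x ^ (Suc (card D) - card C)) = (\<Sum>C\<in>Pow D. x * x ^ (card D - card C))"
    using insert.hyps by (intro sum.cong refl) (auto simp: Suc_diff_le card_mono)
  finally show ?case
    using insert by (simp flip: sum_distrib_left add: algebra_simps)
qed simp

text \<open>
  The core need not be contained in all the petals, only in one of them; this is what
  improves the bound \<open>i! q ^ i\<close> of the sunflower lemma to \<open>q ^ i\<close>.
\<close>

lemma weak_sunflower:
  assumes "finite F" and "\<And>X. X \<in> F \<Longrightarrow> finite X \<and> card X = i" and "q ^ i < card F"
  shows "\<exists>S W. (\<forall>a\<le>q. S a \<in> F) \<and> (\<forall>a\<le>q. \<forall>b\<le>q. a \<noteq> b \<longrightarrow> S a \<inter> S b \<subseteq> W) \<and> W \<subset> S 0"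
  using assms
proof (induction q arbitrary: F i)
  case 0
  obtain X where X: "X \<in> F" using 0 by fastforce
  have "i \<noteq> 0"
  proof
    assume "i = 0"
    then have "F \<subseteq> {{}}" using 0 card_0_eq by blast
    then have "card F \<le> card {{} :: 'a set}" by (intro card_mono) auto
    then show False using 0 \<open>i = 0\<close> by simp
  qed
  then have "X \<noteq> {}" using "0.prems"(2)[OF X] by auto
  \<comment> \<open>With \<open>q = 0\<close> there is one petal and no pair, so the empty set is a
    proper core.\<close>
  then show ?case using X by (intro exI[of _ "\<lambda>_. X"] exI[of _ "{}"]) auto
next
  case (Suc q)
  obtain D where D: "D \<in> F" using Suc.prems by fastforce
  then have fD: "finite D" "card D = i" using Suc.prems by auto
  define T where "T C = {E \<in> F. E \<inter> D = C}" for C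
  \<comment> \<open>Sort \<open>F\<close> by the trace on one member \<open>D\<close>. If every
    class were within the bound for \<open>q\<close> and exponent \<open>i - card C\<close>, all of
    them together would have at most \<open>(q + 1) ^ i\<close> members.\<close>
  have "\<exists>C\<in>Pow D. q ^ (i - card C) < card (T C)"
  proof (rule ccontr)
    assume "\<not> ?thesis"
    then have le: "card (T C) \<le> q ^ (i - card C)" if "C \<in> Pow D" for C
      using that by (simp add: not_less)
    have "E \<in> T (E \<inter> D)" if "E \<in> F" for E using that by (simp add: T_def)
    then have "F \<subseteq> (\<Union>C\<in>Pow D. T C)" by blast
    moreover have "finite (\<Union>C\<in>Pow D. T C)" using fD Suc.prems(1) by (simp add: T_def)
    ultimately have "card F \<le> card (\<Union>C\<in>Pow D. T C)" by (rule card_mono[rotated])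
    also have "\<dots> \<le> (\<Sum>C\<in>Pow D. card (T C))"
      using fD by (intro card_UN_le) simp
    also have "\<dots> \<le> (\<Sum>C\<in>Pow D. q ^ (i - card C))" by (intro sum_mono le)
    also have "\<dots> = (q + 1) ^ i" using sum_Pow_power_card_diff[of D q] fD by simp
    finally show False using Suc.prems by simp
  qed
  then obtain C where C: "C \<subseteq> D" "q ^ (i - card C) < card (T C)" by auto
  define G where "G = (\<lambda>E. E - C) ` T C"
  have CE: "C \<subseteq> E" if "E \<in> T C" for E using that by (auto simp: T_def)
  have inj: "inj_on (\<lambda>E. E - C) (T C)"
    by (rule inj_onI) (metis CE Diff_partition)
  have "finite G" using Suc.prems by (simp add: G_def T_def)
  moreover have "finite X \<and> card X = i - card C" if "X \<in> G" for X
  proof -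
    from that obtain E where E: "E \<in> T C" "X = E - C" by (auto simp: G_def)
    then have "finite E" "card E = i" using Suc.prems by (auto simp: T_def)
    with E CE[of E] show ?thesis by (auto intro: card_Diff_subset finite_subset)
  qed
  moreover have "q ^ (i - card C) < card G" using C card_image[OF inj] by (simp add: G_def)
  ultimately obtain S W where S: "\<forall>a\<le>q. S a \<in> G"
      "\<forall>a\<le>q. \<forall>b\<le>q. a \<noteq> b \<longrightarrow> S a \<inter> S b \<subseteq> W" "W \<subset> S 0"
    using Suc.IH[of G "i - card C"] by metis
  \<comment> \<open>\<open>D\<close> becomes the additional petal. Every petal from the class of
    \<open>C\<close> meets it exactly in \<open>C\<close>, which is returned to the core.\<close>
  define S' where "S' a = (if a \<le> q then S a \<union> C else D)" for a
  have ST: "S a \<union> C \<in> T C \<and> S a \<inter> C = {}" if "a \<le> q" for a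
  proof -
    have "S a \<in> G" using S(1) that by blast
    then obtain E where "E \<in> T C" "S a = E - C" unfolding G_def by blast
    moreover from this have "S a \<union> C = E" using CE[of E] by blast
    ultimately show ?thesis by auto
  qed
  have "\<forall>a\<le>Suc q. S' a \<in> F" using ST D by (auto simp: S'_def T_def)
  moreover have "\<forall>a\<le>Suc q. \<forall>b\<le>Suc q. a \<noteq> b \<longrightarrow> S' a \<inter> S' b \<subseteq> W \<union> C"
  proof (intro allI impI)
    fix a b assume ab: "a \<le> Suc q" "b \<le> Suc q" "a \<noteq> b"
    have "a \<le> q \<or> b \<le> q" using ab by auto
    moreover have "(S a \<union> C) \<inter> (S b \<union> C) \<subseteq> W \<union> C" if "a \<le> q" "b \<le> q"
      using S(2) that \<open>a \<noteq> b\<close> by blast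
    moreover have "(S a \<union> C) \<inter> D = C" if "a \<le> q" for a using ST[OF that] by (auto simp: T_def)
    ultimately show "S' a \<inter> S' b \<subseteq> W \<union> C"
      by (cases "a \<le> q"; cases "b \<le> q") (simp_all add: S'_def Int_commute)
  qed
  moreover have "W \<union> C \<subset> S' 0"
  proof -
    have "S' 0 = S 0 \<union> C" by (simp add: S'_def)
    moreover have "S 0 \<inter> C = {}" using ST by blast
    ultimately show ?thesis using S(3) by blast
  qed
  ultimately show ?case by blast
qed

text \<open>Once \<open>i\<close> points of \<open>X\<close> are covered, a random
  \<open>k\<close>-set covers the next one with probability \<open>(k - i) / (card V - i)\<close>,
  which is at most \<open>k / card V\<close>. The product of these bounds is multiplied out to stay
  in the naturals.\<close>

lemma card_supersets_of_card:
  assumes "finite V" and "X \<subseteq> V" and "k \<le> card V"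
  shows "card V ^ card X * card {Z. Z \<subseteq> V \<and> card Z = k \<and> X \<subseteq> Z} \<le> k ^ card X * (card V choose k)"
proof (cases "card X \<le> k")
  case True
  have fX: "finite X" using assms finite_subset by auto
  have "bij_betw (\<lambda>Z. Z - X) {Z. Z \<subseteq> V \<and> card Z = k \<and> X \<subseteq> Z} {Y. Y \<subseteq> V - X \<and> card Y = k - card X}"
  proof (rule bij_betwI[where g = "\<lambda>Y. Y \<union> X"])
    show "(\<lambda>Z. Z - X) \<in> {Z. Z \<subseteq> V \<and> card Z = k \<and> X \<subseteq> Z} \<rightarrow> {Y. Y \<subseteq> V - X \<and> card Y = k - card X}"
      using fX by (auto simp: card_Diff_subset)
    show "(\<lambda>Y. Y \<union> X) \<in> {Y. Y \<subseteq> V - X \<and> card Y = k - card X} \<rightarrow> {Z. Z \<subseteq> V \<and> card Z = k \<and> X \<subseteq> Z}"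
    proof (clarsimp, intro conjI)
      fix Y assume Y: "Y \<subseteq> V - X" "card Y = k - card X"
      then show "Y \<subseteq> V" "X \<subseteq> V" using assms by auto
      show "card (Y \<union> X) = k"
        using Y fX True assms by (subst card_Un_disjoint) (auto intro: finite_subset)
    qed
  qed auto
  then have "card {Z. Z \<subseteq> V \<and> card Z = k \<and> X \<subseteq> Z} = (card V - card X) choose (k - card X)"
    using assms fX by (simp add: bij_betw_same_card n_subsets card_Diff_subset)
  moreover have "n ^ i * ((n - i) choose (k - i)) \<le> k ^ i * (n choose k)" if "i \<le> k" "k \<le> n" for n i
    using that
  proof (induction i)
    case (Suc i)
    let ?a = "(n - Suc i) choose (k - Suc i)" and ?b = "(n - i) choose (k - i)"
    have eq: "(n - i) * ?a = (k - i) * ?b"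
      using Suc_times_binomial_eq[of "n - Suc i" "k - Suc i"] Suc.prems by (simp add: Suc_diff_Suc mult.commute)
    have "(n - i) * (n ^ Suc i * ?a) = n ^ i * ?b * (n * (k - i))"
      using arg_cong[OF eq, of "\<lambda>m. n ^ Suc i * m"] by (simp add: mult_ac)
    also have "\<dots> \<le> n ^ i * ?b * (k * (n - i))"
      using Suc.prems by (intro mult_le_mono2) (simp add: diff_mult_distrib2 mult.commute diff_le_mono2)
    also have "\<dots> \<le> k ^ i * (n choose k) * (k * (n - i))"
      using Suc by (intro mult_le_mono1) auto
    finally have "(n - i) * (n ^ Suc i * ?a) \<le> (n - i) * (k ^ Suc i * (n choose k))"
      by (simp add: mult_ac)
    then show ?case using Suc.prems by simp
  qed simp
  ultimately show ?thesis using True assms by simp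
next
  case False
  have "{Z. Z \<subseteq> V \<and> card Z = k \<and> X \<subseteq> Z} = {}"
    using False assms card_mono finite_subset by blast
  then show ?thesis by (simp only: card.empty)
qed

lemma card_subsets_card_le:
  assumes "finite V"
  shows "card {X. X \<subseteq> V \<and> card X \<le> r} \<le> (card V + 1) ^ r"
proof (induction r)
  case 0
  have "{X. X \<subseteq> V \<and> card X \<le> 0} \<subseteq> {{}}" using assms by (auto dest: finite_subset)
  then show ?case using card_mono[of "{{}}" "{X. X \<subseteq> V \<and> card X \<le> 0}"] by simp
next
  case (Suc r)
  have "{X. X \<subseteq> V \<and> card X \<le> Suc r} = {X. X \<subseteq> V \<and> card X \<le> r} \<union> {X. X \<subseteq> V \<and> card X = Suc r}"
    by auto
  then have "card {X. X \<subseteq> V \<and> card X \<le> Suc r} \<le> card {X. X \<subseteq> V \<and> card X \<le> r} + (card V choose Suc r)"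
    using card_Un_le[of "{X. X \<subseteq> V \<and> card X \<le> r}" "{X. X \<subseteq> V \<and> card X = Suc r}"]
    by (simp only: n_subsets[OF assms])
  also have "\<dots> \<le> (card V + 1) ^ r + card V ^ Suc r"
  proof (intro add_mono Suc)
    show "card V choose Suc r \<le> card V ^ Suc r"
      using binomial_le_pow[of "Suc r" "card V"]
      by (cases "Suc r \<le> card V") (simp_all add: not_le binomial_eq_0)
  qed
  also have "\<dots> \<le> (card V + 1) ^ r + card V * (card V + 1) ^ r"
    by (auto intro: power_mono)
  finally show ?case by simp
qed

text \<open>
  Union bound over the pairs of \<open>X\<close> that are not inside \<open>W\<close>: one of the two vertices of such a pair
  can be recoloured freely.
\<close>

lemma card_not_inj_on_colorings_le:
  assumes "finite V" and "finite L" and "G \<subseteq> V \<rightarrow>\<^sub>E L" and "X \<subseteq> V"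
    and "\<And>c. c \<in> G \<Longrightarrow> inj_on c W"
    and recol: "\<And>c x d. c \<in> G \<Longrightarrow> x \<in> X - W \<Longrightarrow> d \<in> L \<Longrightarrow> c(x := d) \<in> G"
    and "2 * card X ^ 2 \<le> card L"
  shows "2 * card {c \<in> G. \<not> inj_on c X} \<le> card G"
proof (cases "card L = 0")
  case True
  then have "X = {}" using assms by (auto dest: finite_subset)
  then show ?thesis by simp
next
  case False
  have fG: "finite G" using assms finite_PiE finite_subset by metis
  have fX: "finite X" using assms finite_subset by auto
  \<comment> \<open>The pairs are ordered: the first point gets recoloured and must avoid
    \<open>W\<close>, while the second may lie in \<open>W\<close>.\<close>
  define Pr where "Pr = {(x, y). x \<in> X - W \<and> y \<in> X \<and> x \<noteq> y}"
  have Pr: "Pr \<subseteq> X \<times> X" by (auto simp: Pr_def)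
  then have fPr: "finite Pr" using fX finite_subset by blast
  define B where "B = (\<lambda>(x, y). {c \<in> G. c x = c y})"
  have B: "card L * card (B z) \<le> card G" if zPr: "z \<in> Pr" for z
  proof -
    obtain x y where z: "z = (x, y)" "x \<in> X - W" "y \<in> X" "x \<noteq> y" using zPr unfolding Pr_def by blast
    \<comment> \<open>The overwritten colour of \<open>x\<close> can be read off at the untouched
      \<open>y\<close>, since \<open>c x = c y\<close>.\<close>
    have "inj_on (\<lambda>(c, d). c(x := d)) (B z \<times> L)"
    proof (rule inj_onI, clarsimp)
      fix c d c' d' assume *: "c \<in> B z" "c' \<in> B z" "c(x := d) = c'(x := d')"
      have y: "c y = c' y" using fun_cong[OF *(3), of y] z by simp
      have "c v = c' v" for v
      proof (cases "v = x")
        case True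
        then show ?thesis using * z y by (simp add: B_def)
      next
        case False
        then show ?thesis using fun_cong[OF *(3), of v] by simp
      qed
      moreover have "d = d'" using fun_cong[OF *(3), of x] by simp
      ultimately show "c = c' \<and> d = d'" by auto
    qed
    moreover have "(\<lambda>(c, d). c(x := d)) ` (B z \<times> L) \<subseteq> G"
      using recol z by (auto simp: B_def)
    ultimately have "card (B z \<times> L) \<le> card G" using fG by (rule card_inj_on_le)
    then show ?thesis by (simp add: card_cartesian_product mult.commute)
  qed
  have "{c \<in> G. \<not> inj_on c X} \<subseteq> (\<Union>z\<in>Pr. B z)"
  proof
    fix c assume c: "c \<in> {c \<in> G. \<not> inj_on c X}"
    then obtain x y where xy: "x \<in> X" "y \<in> X" "x \<noteq> y" "c x = c y" by (auto simp: inj_on_def)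
    then have "x \<notin> W \<or> y \<notin> W" using assms(5)[of c] c by (auto simp: inj_on_def)
    then have "(x, y) \<in> Pr \<or> (y, x) \<in> Pr" using xy by (auto simp: Pr_def)
    moreover have "c \<in> B (x, y)" "c \<in> B (y, x)" using c xy by (simp_all add: B_def)
    ultimately show "c \<in> (\<Union>z\<in>Pr. B z)" by blast
  qed
  moreover have "finite (\<Union>z\<in>Pr. B z)" using fPr fG by (auto simp: B_def)
  ultimately have "card {c \<in> G. \<not> inj_on c X} \<le> card (\<Union>z\<in>Pr. B z)" by (rule card_mono[rotated])
  also have "\<dots> \<le> (\<Sum>z\<in>Pr. card (B z))" by (rule card_UN_le[OF fPr])
  finally have "card L * card {c \<in> G. \<not> inj_on c X} \<le> (\<Sum>z\<in>Pr. card L * card (B z))"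
    by (simp flip: sum_distrib_left)
  also have "\<dots> \<le> (\<Sum>z\<in>Pr. card G)" by (intro sum_mono B)
  also have "\<dots> = card Pr * card G" by simp
  also have "\<dots> \<le> card X ^ 2 * card G"
    using card_mono[OF _ Pr] fX by (intro mult_le_mono1) (simp add: card_cartesian_product power2_eq_square)
  finally have "card L * (2 * card {c \<in> G. \<not> inj_on c X}) \<le> (2 * card X ^ 2) * card G" by simp
  also have "\<dots> \<le> card L * card G" using assms by (intro mult_le_mono1) auto
  finally show ?thesis using False by simp
qed

section \<open>The approximation method\<close>

text \<open>
  A circuit is represented by the set of functions that its gates compute on graphs;
  \<open>s\<close> bounds the number of gates.
\<close>

inductive mono_gates :: "'a set \<Rightarrow> nat \<Rightarrow> (('a \<Rightarrow> 'a \<Rightarrow> bool) \<Rightarrow> bool) set \<Rightarrow> bool" for V where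
  empty: "mono_gates V 0 {}"
| const: "mono_gates V s F \<Longrightarrow> mono_gates V (Suc s) (insert (\<lambda>_. b) F)"
| edge: "mono_gates V s F \<Longrightarrow> i \<in> V \<Longrightarrow> j \<in> V \<Longrightarrow> i \<noteq> j \<Longrightarrow> mono_gates V (Suc s) (insert (\<lambda>e. e i j) F)"
| conj: "mono_gates V s F \<Longrightarrow> f \<in> F \<Longrightarrow> g \<in> F \<Longrightarrow> mono_gates V (Suc s) (insert (\<lambda>e. f e \<and> g e) F)"
| disj: "mono_gates V s F \<Longrightarrow> f \<in> F \<Longrightarrow> g \<in> F \<Longrightarrow> mono_gates V (Suc s) (insert (\<lambda>e. f e \<or> g e) F)"

definition clique_graph :: "'a set \<Rightarrow> 'a \<Rightarrow> 'a \<Rightarrow> bool" where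
  "clique_graph Z i j \<longleftrightarrow> i \<in> Z \<and> j \<in> Z"

definition multipartite_graph :: "('a \<Rightarrow> 'b) \<Rightarrow> 'a \<Rightarrow> 'a \<Rightarrow> bool" where
  "multipartite_graph c i j \<longleftrightarrow> c i \<noteq> c j"

text \<open>By \<open>2 * r ^ 2 \<le> card L\<close>, at least half of the colourings are injective
  on a given set of size at most \<open>r\<close>. By \<open>2 * p * k \<le> card V\<close>, the
  ratio \<open>p * k / card V\<close> of the geometric series in
  \<open>card_large_minimal_le\<close> is at most 1/2.\<close>

locale clique_color_approximation =
  fixes V :: "'a set" and L :: "'b set" and k r p :: nat
  assumes finV: "finite V" and finL: "finite L"
    and k: "0 < k" "k \<le> card V" and r: "2 \<le> r" "2 * r ^ 2 \<le> card L"
    and p: "2 \<le> p" "2 * p * k \<le> card V"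
begin

section \<open>Approximators, acceptance and closed families\<close>

definition sets where "sets = {X. X \<subseteq> V \<and> card X \<le> r}"
definition cliques where "cliques = {Z. Z \<subseteq> V \<and> card Z = k}"
definition colorings where "colorings = (V \<rightarrow>\<^sub>E L)"

text \<open>The value of an approximator on the two kinds of test graphs. A set spans a clique in
  \<open>multipartite_graph c\<close> iff \<open>c\<close> is injective on it. On
  \<open>clique_graph Z\<close> it has to lie in \<open>Z\<close>, which for a single vertex demands
  more than spanning a clique.\<close>

definition cl_acc :: "'a set set \<Rightarrow> 'a set \<Rightarrow> bool" where
  "cl_acc A Z \<longleftrightarrow> (\<exists>X\<in>A. X \<subseteq> Z)"
definition co_acc :: "'a set set \<Rightarrow> ('a \<Rightarrow> 'b) \<Rightarrow> bool" where
  "co_acc A c \<longleftrightarrow> (\<exists>X\<in>A. inj_on c X)"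

text \<open>The sets \<open>S a\<close> may coincide, so that closed families are closed under supersets of size at most \<open>r\<close>.\<close>

definition derives :: "'a set set \<Rightarrow> 'a set \<Rightarrow> bool" where
  "derives A W \<longleftrightarrow> (\<exists>S. (\<forall>a<p. S a \<in> A) \<and> (\<forall>a<p. \<forall>b<p. a \<noteq> b \<longrightarrow> S a \<inter> S b \<subseteq> W))"

definition closed :: "'a set set \<Rightarrow> bool" where
  "closed A \<longleftrightarrow> A \<subseteq> sets \<and> (\<forall>W\<in>sets. derives A W \<longrightarrow> W \<in> A)"

lemma finite_sets: "finite sets" and finite_cliques: "finite cliques"
  and finite_colorings: "finite colorings"
  using finV finL by (auto simp: sets_def cliques_def colorings_def intro: finite_PiE)

lemma card_cliques: "card cliques = card V choose k"
  using n_subsets[OF finV] by (simp add: cliques_def)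

lemma setsD: "X \<in> sets \<Longrightarrow> X \<subseteq> V \<and> finite X \<and> card X \<le> r"
  using finV finite_subset by (auto simp: sets_def)

lemma closed_superset:
  assumes "closed A" and "X \<in> A" and "X \<subseteq> Y" and "Y \<in> sets"
  shows "Y \<in> A"
proof -
  have "derives A Y" unfolding derives_def using assms by (intro exI[of _ "\<lambda>_. X"]) auto
  then show ?thesis using assms by (auto simp: closed_def)
qed

lemma closed_Int: "closed A \<Longrightarrow> closed B \<Longrightarrow> closed (A \<inter> B)"
  unfolding closed_def derives_def by blast

lemma closed_sets: "closed sets"
  by (auto simp: closed_def)

lemma closed_empty: "closed {}"
  using p by (force simp: closed_def derives_def)

text \<open>Two of the sets in a derivation already intersect in a superset of \<open>E\<close>.
  With \<open>E\<close> an edge, this family approximates an input gate without error.\<close>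

lemma closed_supersets: "closed {X \<in> sets. E \<subseteq> X}"
proof -
  have "E \<subseteq> W" if "derives {X \<in> sets. E \<subseteq> X} W" for W
  proof -
    from that obtain S where S: "\<forall>a<p. E \<subseteq> S a" "\<forall>a<p. \<forall>b<p. a \<noteq> b \<longrightarrow> S a \<inter> S b \<subseteq> W"
      unfolding derives_def by auto
    have "0 < p" "1 < p" using p by auto
    with S have "E \<subseteq> S 0" "E \<subseteq> S 1" "S 0 \<inter> S 1 \<subseteq> W" by simp_all
    then show ?thesis by blast
  qed
  then show ?thesis by (auto simp: closed_def)
qed

section \<open>Minimal sets and the loss of cliques at conjunctions\<close>

definition minimal :: "'a set set \<Rightarrow> 'a set set" where
  "minimal A = {X \<in> A. \<forall>Y\<in>A. \<not> Y \<subset> X}"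

lemma cl_acc_minimal:
  assumes "A \<subseteq> sets" and "cl_acc A Z"
  obtains X where "X \<in> minimal A" and "X \<subseteq> Z"
proof -
  let ?B = "{X \<in> A. X \<subseteq> Z}"
  have B: "finite ?B" "?B \<noteq> {}"
    using assms finite_subset[OF _ finite_sets] by (auto simp: cl_acc_def)
  obtain X where "X \<in> ?B" "\<forall>Y\<in>?B. Y \<subseteq> X \<longrightarrow> X = Y"
    using finite_has_minimal[OF B] by blast
  then show ?thesis by (intro that[of X]) (auto simp: minimal_def)
qed

text \<open>Otherwise \<open>weak_sunflower\<close> yields a core that is derived from
  \<open>A\<close>, hence in \<open>A\<close>, and properly contained in a minimal set.\<close>

lemma card_minimal_le:
  assumes "closed A"
  shows "card {X \<in> minimal A. card X = i} \<le> (p - 1) ^ i"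
proof (rule ccontr)
  let ?F = "{X \<in> minimal A. card X = i}"
  assume "\<not> ?thesis"
  then have big: "(p - 1) ^ i < card ?F" by simp
  have A: "A \<subseteq> sets" using assms by (simp add: closed_def)
  then have fF: "finite ?F" using finite_subset[OF _ finite_sets] by (auto simp: minimal_def)
  have sz: "\<And>X. X \<in> ?F \<Longrightarrow> finite X \<and> card X = i"
    using A setsD by (auto simp: minimal_def)
  \<comment> \<open>The indices from 0 to \<open>p - 1\<close> are the \<open>p\<close> sets of a
    derivation.\<close>
  obtain S W where S: "\<forall>a\<le>p - 1. S a \<in> ?F"
      "\<forall>a\<le>p - 1. \<forall>b\<le>p - 1. a \<noteq> b \<longrightarrow> S a \<inter> S b \<subseteq> W" "W \<subset> S 0"
    using weak_sunflower[OF fF sz big] by blast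
  have lt: "a \<le> p - 1" if "a < p" for a using that by simp
  have dW: "derives A W"
    unfolding derives_def using S lt by (intro exI[of _ S]) (auto simp: minimal_def)
  have S0: "S 0 \<in> minimal A" using S(1) by simp
  then have "S 0 \<in> sets" using A by (auto simp: minimal_def)
  then have "S 0 \<subseteq> V" "finite (S 0)" "card (S 0) \<le> r" using setsD by auto
  moreover from this have "card W \<le> card (S 0)" using S(3) by (intro card_mono) auto
  ultimately have "W \<in> sets" using S(3) unfolding sets_def by auto
  then have "W \<in> A" using assms dW by (auto simp: closed_def)
  then show False using S0 S(3) by (auto simp: minimal_def)
qed

text \<open>Two sets whose union has more than \<open>r\<close> elements cannot both have fewer than
  \<open>h\<close>.\<close>

definition h where "h = (r + 1) div 2"

definition large_minimal :: "'a set set \<Rightarrow> 'a set set" where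
  "large_minimal A = {Z \<in> cliques. \<exists>X\<in>minimal A. X \<subseteq> Z \<and> h \<le> card X}"

text \<open>There are at most \<open>p ^ i\<close> minimal sets of size \<open>i\<close>, and each
  lies in at most a fraction \<open>(k / card V) ^ i\<close> of the cliques. The products are at
  most \<open>(1/2) ^ i\<close>, and their sum from \<open>h\<close> on is at most
  \<open>2 * (1/2) ^ h\<close>.\<close>

lemma card_large_minimal_le:
  assumes "closed A"
  shows "2 ^ h * card (large_minimal A) \<le> 2 * card cliques"
proof -
  let ?n = "card V"
  define M where "M i = {X \<in> minimal A. card X = i}" for i
  define Up where "Up X = {Z. Z \<subseteq> V \<and> card Z = k \<and> X \<subseteq> Z}" for X
  have n: "0 < ?n" using k by linarith
  have A: "A \<subseteq> sets" using assms by (simp add: closed_def)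
  have M: "finite (M i)" "M i \<subseteq> sets" for i
    using A finite_subset[OF _ finite_sets] by (auto simp: minimal_def M_def)
  have Up: "real (card (Up X)) \<le> (real k / ?n) ^ card X * card cliques" if "X \<in> sets" for X
  proof -
    have "?n ^ card X * card (Up X) \<le> k ^ card X * card cliques"
      using card_supersets_of_card[OF finV _ k(2), of X] setsD[OF that]
      by (simp add: Up_def card_cliques)
    then have "real ?n ^ card X * real (card (Up X)) \<le> real k ^ card X * real (card cliques)"
      by (metis of_nat_mono of_nat_mult of_nat_power)
    then show ?thesis using n by (simp add: field_simps power_divide)
  qed
  have fUp: "finite (Up X)" for X using finV by (simp add: Up_def)
  have "large_minimal A \<subseteq> (\<Union>i\<in>{h..<Suc r}. \<Union>X\<in>M i. Up X)"
  proof
    fix Z assume "Z \<in> large_minimal A"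
    then obtain X where X: "Z \<in> cliques" "X \<in> minimal A" "X \<subseteq> Z" "h \<le> card X"
      by (auto simp: large_minimal_def)
    then have "card X \<le> r" using A setsD[of X] by (auto simp: minimal_def)
    then show "Z \<in> (\<Union>i\<in>{h..<Suc r}. \<Union>X\<in>M i. Up X)"
      using X by (intro UN_I[of "card X"] UN_I[of X]) (auto simp: M_def Up_def cliques_def)
  qed
  then have "card (large_minimal A) \<le> card (\<Union>i\<in>{h..<Suc r}. \<Union>X\<in>M i. Up X)"
    using M fUp by (intro card_mono) auto
  also have "\<dots> \<le> (\<Sum>i=h..<Suc r. card (\<Union>X\<in>M i. Up X))"
    by (intro card_UN_le) simp
  also have "\<dots> \<le> (\<Sum>i=h..<Suc r. \<Sum>X\<in>M i. card (Up X))"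
    using M by (intro sum_mono card_UN_le)
  finally have "real (card (large_minimal A)) \<le> (\<Sum>i=h..<Suc r. \<Sum>X\<in>M i. real (card (Up X)))"
    by (metis (mono_tags, lifting) of_nat_mono of_nat_sum sum.cong)
  also have "\<dots> \<le> (\<Sum>i=h..<Suc r. (1/2) ^ i * card cliques)"
  proof (rule sum_mono)
    fix i
    have "(\<Sum>X\<in>M i. real (card (Up X))) \<le> (\<Sum>X\<in>M i. (real k / ?n) ^ i * card cliques)"
    proof (rule sum_mono)
      fix X assume "X \<in> M i"
      then show "real (card (Up X)) \<le> (real k / ?n) ^ i * card cliques"
        using Up[of X] M by (auto simp: M_def)
    qed
    also have "\<dots> = card (M i) * ((real k / ?n) ^ i * card cliques)" by simp
    also have "\<dots> \<le> real p ^ i * ((real k / ?n) ^ i * card cliques)"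
    proof (intro mult_right_mono)
      have "card (M i) \<le> p ^ i"
        using card_minimal_le[OF assms, of i] power_mono[of "p - 1" p i] by (auto simp: M_def)
      then show "real (card (M i)) \<le> real p ^ i" by (metis of_nat_mono of_nat_power)
    qed auto
    also have "\<dots> = (real p * k / ?n) ^ i * card cliques" by (simp add: power_mult_distrib power_divide)
    also have "\<dots> \<le> (1/2) ^ i * card cliques"
    proof (intro mult_right_mono power_mono)
      have "2 * (real p * k) \<le> ?n" using p(2) by (metis (mono_tags, lifting) mult.assoc of_nat_mono of_nat_mult of_nat_numeral)
      then show "real p * k / ?n \<le> 1/2" using n by (simp add: field_simps)
    qed auto
    finally show "(\<Sum>X\<in>M i. real (card (Up X))) \<le> (1/2) ^ i * card cliques" .
  qed
  also have "\<dots> = (\<Sum>i=h..<Suc r. (1/2) ^ i) * card cliques" by (simp only: sum_distrib_right)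
  also have "(\<Sum>i=h..<Suc r. (1/2::real) ^ i) \<le> 2 * (1/2) ^ h"
  proof -
    \<comment> \<open>The added term turns the bound on the geometric tail into one that passes
      through the induction.\<close>
    have "(\<Sum>i=h..<m. (1/2::real) ^ i) + 2 * (1/2) ^ m \<le> 2 * (1/2) ^ h" if "h \<le> m" for m
      using that by (induction m rule: dec_induct) auto
    moreover have "h \<le> Suc r" by (simp add: h_def)
    moreover have "(0::real) \<le> 2 * (1/2) ^ Suc r" by simp
    ultimately show ?thesis by (meson add_increasing2 order_trans order_refl)
  qed
  finally have "real (card (large_minimal A)) \<le> 2 * (1/2) ^ h * card cliques"
    by (simp add: mult_right_mono)
  then have "real (2 ^ h * card (large_minimal A)) \<le> real (2 * card cliques)"
    by (simp add: field_simps power_divide)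
  then show ?thesis by linarith
qed

text \<open>If \<open>X \<in> A\<close> and \<open>Y \<in> B\<close> lie in \<open>Z\<close> but \<open>X \<union> Y\<close> is too big, then one of them is large.\<close>

lemma conj_error_subset:
  assumes "closed A" and "closed B"
  shows "{Z \<in> cliques. cl_acc A Z \<and> cl_acc B Z \<and> \<not> cl_acc (A \<inter> B) Z} \<subseteq> large_minimal A \<union> large_minimal B"
proof
  fix Z assume "Z \<in> {Z \<in> cliques. cl_acc A Z \<and> cl_acc B Z \<and> \<not> cl_acc (A \<inter> B) Z}"
  then have Z: "Z \<in> cliques" "cl_acc A Z" "cl_acc B Z" "\<not> cl_acc (A \<inter> B) Z" by auto
  have AB: "A \<subseteq> sets" "B \<subseteq> sets" using assms by (auto simp: closed_def)
  obtain X where X: "X \<in> minimal A" "X \<subseteq> Z" using cl_acc_minimal AB Z by blast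
  obtain Y where Y: "Y \<in> minimal B" "Y \<subseteq> Z" using cl_acc_minimal AB Z by blast
  have XY: "X \<in> A" "Y \<in> B" using X Y by (auto simp: minimal_def)
  have "X \<union> Y \<notin> sets"
  proof
    assume "X \<union> Y \<in> sets"
    then have "X \<union> Y \<in> A \<inter> B" using closed_superset assms XY by (meson IntI Un_upper1 Un_upper2)
    then show False using Z X Y unfolding cl_acc_def by blast
  qed
  moreover have "X \<union> Y \<subseteq> V" using XY AB setsD by blast
  ultimately have "r < card (X \<union> Y)" by (auto simp: sets_def)
  then have "r < card X + card Y" using card_Un_le[of X Y] by linarith
  then have "h \<le> card X \<or> h \<le> card Y" unfolding h_def by linarith
  then show "Z \<in> large_minimal A \<union> large_minimal B"
    using X Y Z by (auto simp: large_minimal_def)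
qed

section \<open>Closures and the wrongly accepted colourings at disjunctions\<close>

text \<open>Outside \<open>W\<close> the \<open>p\<close> sets are disjoint. Among the colourings
  that are injective on \<open>W\<close> and on none of the earlier sets, the next set can still be
  recoloured freely outside \<open>W\<close>, so each further failure at least halves their
  number.\<close>

lemma card_derived_error_le:
  assumes "A \<subseteq> sets" and "W \<in> sets" and "derives A W"
  shows "2 ^ p * card {c \<in> colorings. inj_on c W \<and> \<not> co_acc A c} \<le> card colorings"
proof -
  obtain S where S: "\<And>a. a < p \<Longrightarrow> S a \<in> A" "\<And>a b. a < p \<Longrightarrow> b < p \<Longrightarrow> a \<noteq> b \<Longrightarrow> S a \<inter> S b \<subseteq> W"
    using assms(3) unfolding derives_def by metis
  define T where "T m = {c \<in> colorings. inj_on c W \<and> (\<forall>a<m. \<not> inj_on c (S a))}" for m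
  have "2 ^ m * card (T m) \<le> card colorings" if "m \<le> p" for m
    using that
  proof (induction m)
    case 0
    then show ?case using card_mono[OF finite_colorings, of "T 0"] by (auto simp: T_def)
  next
    case (Suc m)
    have Sm: "S m \<in> sets" using S(1)[of m] Suc.prems assms by auto
    have "2 * card {c \<in> T m. \<not> inj_on c (S m)} \<le> card (T m)"
    proof (rule card_not_inj_on_colorings_le[OF finV finL, where W = W])
      show "T m \<subseteq> V \<rightarrow>\<^sub>E L" by (auto simp: T_def colorings_def)
      show "S m \<subseteq> V" using setsD[OF Sm] by simp
      show "inj_on c W" if "c \<in> T m" for c using that by (simp add: T_def)
      have "card (S m) ^ 2 \<le> r ^ 2" using setsD[OF Sm] by (intro power_mono) auto
      then show "2 * card (S m) ^ 2 \<le> card L" using r by linarith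
      fix c x d assume c: "c \<in> T m" "x \<in> S m - W" "d \<in> L"
      have "x \<in> V" using c setsD[OF Sm] by auto
      then have "c(x := d) \<in> colorings"
        using c by (auto simp: T_def colorings_def PiE_def extensional_def)
      moreover have same: "inj_on (c(x := d)) Y \<longleftrightarrow> inj_on c Y" if "x \<notin> Y" for Y
        using that by (intro inj_on_cong) auto
      \<comment> \<open>A point of \<open>S m\<close> outside \<open>W\<close> lies in no earlier
        \<open>S a\<close>, so recolouring it preserves the earlier failures.\<close>
      moreover have "x \<notin> S a" if "a < m" for a
        using S(2)[of a m] that Suc.prems c(2) by auto
      ultimately show "c(x := d) \<in> T m" using c by (auto simp: T_def)
    qed
    moreover have "{c \<in> T m. \<not> inj_on c (S m)} = T (Suc m)"
      by (auto simp: T_def less_Suc_eq)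
    ultimately have "2 ^ m * (2 * card (T (Suc m))) \<le> 2 ^ m * card (T m)" by simp
    also have "\<dots> \<le> card colorings" using Suc by simp
    finally show ?case by (simp add: mult_ac)
  qed
  moreover have "{c \<in> colorings. inj_on c W \<and> \<not> co_acc A c} \<subseteq> T p"
    using S(1) by (auto simp: T_def co_acc_def)
  then have "card {c \<in> colorings. inj_on c W \<and> \<not> co_acc A c} \<le> card (T p)"
    using finite_colorings by (intro card_mono) (auto simp: T_def)
  ultimately show ?thesis using le_trans mult_le_mono2 by blast
qed

text \<open>Derived sets are added one at a time, each at the cost given by
  \<open>card_derived_error_le\<close>, and there is room for at most \<open>card sets\<close> of
  them. Instead of an iteration, a maximal family obeying the accumulated error bound is taken; it
  must be closed.\<close>

lemma closure_exists:
  assumes "A \<subseteq> sets"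
  obtains B where "closed B" and "A \<subseteq> B"
    and "2 ^ p * card {c \<in> colorings. co_acc B c \<and> \<not> co_acc A c} \<le> card sets * card colorings"
proof -
  let ?err = "\<lambda>B. {c \<in> colorings. co_acc B c \<and> \<not> co_acc A c}"
  define Q where "Q = {B. A \<subseteq> B \<and> B \<subseteq> sets \<and> 2 ^ p * card (?err B) \<le> card B * card colorings}"
  have "Q \<subseteq> Pow sets" by (auto simp: Q_def)
  then have "finite Q" using finite_sets by (meson finite_Pow_iff finite_subset)
  moreover have "A \<in> Q" using assms by (auto simp: Q_def)
  ultimately obtain B where B: "B \<in> Q" and max: "\<And>C. C \<in> Q \<Longrightarrow> B \<subseteq> C \<Longrightarrow> B = C"
    using finite_has_maximal[of Q] by auto
  have Bs: "B \<subseteq> sets" "A \<subseteq> B" "2 ^ p * card (?err B) \<le> card B * card colorings"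
    using B by (auto simp: Q_def)
  have finB: "finite B" using Bs finite_sets finite_subset by auto
  have "W \<in> B" if W: "W \<in> sets" "derives B W" for W
  proof (rule ccontr)
    assume nW: "W \<notin> B"
    let ?E = "{c \<in> colorings. inj_on c W \<and> \<not> co_acc B c}"
    have "?err (insert W B) \<subseteq> ?err B \<union> ?E" by (auto simp: co_acc_def)
    then have "card (?err (insert W B)) \<le> card (?err B \<union> ?E)"
      using finite_colorings by (intro card_mono) auto
    also have "\<dots> \<le> card (?err B) + card ?E" by (rule card_Un_le)
    finally have "2 ^ p * card (?err (insert W B)) \<le> 2 ^ p * card (?err B) + 2 ^ p * card ?E"
      unfolding add_mult_distrib2[symmetric] by (rule mult_le_mono2)
    also have "\<dots> \<le> card B * card colorings + card colorings"
      using Bs card_derived_error_le[OF Bs(1) W] by (intro add_mono)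
    also have "\<dots> = card (insert W B) * card colorings" using nW finB by simp
    finally have "insert W B \<in> Q" using Bs W by (auto simp: Q_def)
    then show False using max[of "insert W B"] nW by blast
  qed
  then have "closed B" using Bs by (auto simp: closed_def)
  moreover have "2 ^ p * card (?err B) \<le> card sets * card colorings"
    using Bs card_mono[OF finite_sets Bs(1)] using le_trans mult_le_mono1 by blast
  ultimately show ?thesis using that Bs by blast
qed

section \<open>Approximating all gates of a circuit\<close>

text \<open>Errors are one-sided: cliques may only be lost in \<open>EP\<close>, colourings may only
  be wrongly accepted in \<open>EN\<close>. The two sets are shared by all gates and grow as gates
  are added.\<close>

definition approximates :: "'a set set \<Rightarrow> ('a \<Rightarrow> 'b) set \<Rightarrow> 'a set set \<Rightarrow> (('a \<Rightarrow> 'a \<Rightarrow> bool) \<Rightarrow> bool) \<Rightarrow> bool" where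
  "approximates EP EN A f \<longleftrightarrow> closed A \<and>
     (\<forall>Z\<in>cliques - EP. f (clique_graph Z) \<longrightarrow> cl_acc A Z) \<and>
     (\<forall>c\<in>colorings - EN. co_acc A c \<longrightarrow> f (multipartite_graph c))"

lemma approximates_mono:
  "approximates EP EN A f \<Longrightarrow> EP \<subseteq> EP' \<Longrightarrow> EN \<subseteq> EN' \<Longrightarrow> approximates EP' EN' A f"
  unfolding approximates_def by blast

lemma approximates_const: "\<exists>A. approximates EP EN A (\<lambda>_. b)"
proof (cases b)
  case True
  have "{} \<in> sets" by (simp add: sets_def)
  then have "approximates EP EN sets (\<lambda>_. b)"
    using True closed_sets by (auto simp: approximates_def cl_acc_def)
  then show ?thesis ..
next
  case False
  then have "approximates EP EN {} (\<lambda>_. b)"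
    using closed_empty by (auto simp: approximates_def co_acc_def)
  then show ?thesis ..
qed

lemma approximates_edge:
  assumes "i \<in> V" "j \<in> V" "i \<noteq> j"
  shows "approximates EP EN {X \<in> sets. {i, j} \<subseteq> X} (\<lambda>e. e i j)"
proof -
  have "{i, j} \<in> sets" using assms r by (auto simp: sets_def)
  then show ?thesis
    using closed_supersets[of "{i, j}"] assms
    by (auto simp: approximates_def cl_acc_def co_acc_def clique_graph_def multipartite_graph_def inj_on_def)
qed

text \<open>Only conjunctions enlarge \<open>EP\<close> and only disjunctions enlarge
  \<open>EN\<close>. The factor 4 comes from two families in a conjunction, each contributing
  \<open>2 * card cliques\<close> by \<open>card_large_minimal_le\<close>.\<close>

lemma mono_gates_approximates:
  assumes "mono_gates V s F"
  shows "\<exists>EP EN. EP \<subseteq> cliques \<and> EN \<subseteq> colorings \<and>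
    2 ^ h * card EP \<le> s * (4 * card cliques) \<and>
    2 ^ p * card EN \<le> s * (card sets * card colorings) \<and>
    (\<forall>f\<in>F. \<exists>A. approximates EP EN A f)"
  using assms
proof induction
  case empty
  show ?case by (intro exI[of _ "{}"]) auto
next
  case (const s F b)
  then obtain EP EN where E: "EP \<subseteq> cliques" "EN \<subseteq> colorings"
    "2 ^ h * card EP \<le> s * (4 * card cliques)"
    "2 ^ p * card EN \<le> s * (card sets * card colorings)"
    "\<forall>f\<in>F. \<exists>A. approximates EP EN A f" by blast
  then show ?case using approximates_const by (intro exI[of _ EP] exI[of _ EN]) auto
next
  case (edge s F i j)
  then obtain EP EN where E: "EP \<subseteq> cliques" "EN \<subseteq> colorings"
    "2 ^ h * card EP \<le> s * (4 * card cliques)"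
    "2 ^ p * card EN \<le> s * (card sets * card colorings)"
    "\<forall>f\<in>F. \<exists>A. approximates EP EN A f" by blast
  moreover have "\<exists>A. approximates EP EN A (\<lambda>e. e i j)" using approximates_edge[OF edge(2-4)] ..
  ultimately show ?case by (intro exI[of _ EP] exI[of _ EN]) auto
next
  case (conj s F f g)
  then obtain EP EN where E: "EP \<subseteq> cliques" "EN \<subseteq> colorings"
    "2 ^ h * card EP \<le> s * (4 * card cliques)"
    "2 ^ p * card EN \<le> s * (card sets * card colorings)"
    "\<forall>f\<in>F. \<exists>A. approximates EP EN A f" by blast
  obtain A where A: "approximates EP EN A f" using E conj by blast
  obtain B where B: "approximates EP EN B g" using E conj by blast
  have cl: "closed A" "closed B" using A B by (auto simp: approximates_def)
  let ?N = "{Z \<in> cliques. cl_acc A Z \<and> cl_acc B Z \<and> \<not> cl_acc (A \<inter> B) Z}"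
  \<comment> \<open>A set in both families witnesses acceptance by both, so intersecting creates no
    error on colourings.\<close>
  have "approximates (EP \<union> ?N) EN (A \<inter> B) (\<lambda>e. f e \<and> g e)"
    using A B closed_Int[OF cl] unfolding approximates_def co_acc_def by blast
  moreover have "\<exists>A. approximates (EP \<union> ?N) EN A f'" if "f' \<in> F" for f'
    using E(5) that approximates_mono[of EP EN _ f' "EP \<union> ?N" EN] by blast
  moreover have "2 ^ h * card (EP \<union> ?N) \<le> Suc s * (4 * card cliques)"
  proof -
    have "card ?N \<le> card (large_minimal A \<union> large_minimal B)"
      using conj_error_subset[OF cl] finite_cliques by (intro card_mono) (auto simp: large_minimal_def)
    then have "card (EP \<union> ?N) \<le> card EP + (card (large_minimal A) + card (large_minimal B))"
      using card_Un_le[of EP ?N] card_Un_le[of "large_minimal A" "large_minimal B"] by linarith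
    then have "2 ^ h * card (EP \<union> ?N) \<le>
        2 ^ h * card EP + (2 ^ h * card (large_minimal A) + 2 ^ h * card (large_minimal B))"
      unfolding add_mult_distrib2[symmetric] by (rule mult_le_mono2)
    then show ?thesis using E(3) card_large_minimal_le[OF cl(1)] card_large_minimal_le[OF cl(2)] by simp
  qed
  moreover have "2 ^ p * card EN \<le> Suc s * (card sets * card colorings)" using E(4) by simp
  ultimately show ?case using E(1,2) by (intro exI[of _ "EP \<union> ?N"] exI[of _ EN]) auto
next
  case (disj s F f g)
  then obtain EP EN where E: "EP \<subseteq> cliques" "EN \<subseteq> colorings"
    "2 ^ h * card EP \<le> s * (4 * card cliques)"
    "2 ^ p * card EN \<le> s * (card sets * card colorings)"
    "\<forall>f\<in>F. \<exists>A. approximates EP EN A f" by blast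
  obtain A where A: "approximates EP EN A f" using E disj by blast
  obtain B where B: "approximates EP EN B g" using E disj by blast
  have "A \<union> B \<subseteq> sets" using A B by (auto simp: approximates_def closed_def)
  then obtain D where D: "closed D" "A \<union> B \<subseteq> D"
    "2 ^ p * card {c \<in> colorings. co_acc D c \<and> \<not> co_acc (A \<union> B) c} \<le> card sets * card colorings"
    using closure_exists by blast
  let ?N = "{c \<in> colorings. co_acc D c \<and> \<not> co_acc (A \<union> B) c}"
  \<comment> \<open>The closure contains both families, so no clique is lost.\<close>
  have "approximates EP (EN \<union> ?N) D (\<lambda>e. f e \<or> g e)"
    using A B D(1,2) unfolding approximates_def cl_acc_def co_acc_def by blast
  moreover have "\<exists>A. approximates EP (EN \<union> ?N) A f'" if "f' \<in> F" for f'
    using E(5) that approximates_mono[of EP EN _ f' EP "EN \<union> ?N"] by blast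
  moreover have "2 ^ p * card (EN \<union> ?N) \<le> Suc s * (card sets * card colorings)"
  proof -
    have "2 ^ p * card (EN \<union> ?N) \<le> 2 ^ p * card EN + 2 ^ p * card ?N"
      unfolding add_mult_distrib2[symmetric] by (intro mult_le_mono2 card_Un_le)
    then show ?thesis using E(4) D(3) by simp
  qed
  moreover have "2 ^ h * card EP \<le> Suc s * (4 * card cliques)" using E(3) by simp
  ultimately show ?case using E(1,2) by (intro exI[of _ EP] exI[of _ "EN \<union> ?N"]) auto
qed

text \<open>The approximator of the output is either empty and loses every clique, or it contains a
  set on which at least half of the colourings are injective, and accepts all of these wrongly.
  Either error must be covered by the small losses per gate.\<close>

theorem mono_gates_lower_bound:
  assumes "mono_gates V s F" and "f \<in> F"
    and pos: "\<And>Z. Z \<subseteq> V \<Longrightarrow> card Z = k \<Longrightarrow> f (clique_graph Z)"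
    and neg: "\<And>c. c \<in> V \<rightarrow>\<^sub>E L \<Longrightarrow> \<not> f (multipartite_graph c)"
  shows "2 ^ ((r + 1) div 2) \<le> 4 * s \<or> 2 ^ p \<le> 2 * s * (card V + 1) ^ r"
proof -
  obtain EP EN where E: "EP \<subseteq> cliques" "EN \<subseteq> colorings"
    "2 ^ h * card EP \<le> s * (4 * card cliques)"
    "2 ^ p * card EN \<le> s * (card sets * card colorings)"
    "\<forall>f\<in>F. \<exists>A. approximates EP EN A f"
    using mono_gates_approximates[OF assms(1)] by blast
  then obtain A where A: "approximates EP EN A f" using assms(2) by blast
  show ?thesis
  proof (cases "A = {}")
    case True
    have "Z \<in> EP" if "Z \<in> cliques" for Z
      using A True pos[of Z] that by (auto simp: approximates_def cl_acc_def cliques_def)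
    then have "EP = cliques" using E(1) by auto
    moreover have "0 < card cliques" using k by (simp add: card_cliques)
    ultimately show ?thesis using E(3) by (simp add: h_def)
  next
    case False
    then obtain X where X: "X \<in> A" by auto
    then have Xs: "X \<in> sets" using A by (auto simp: approximates_def closed_def)
    have "2 * card {c \<in> colorings. \<not> inj_on c X} \<le> card colorings"
    proof (rule card_not_inj_on_colorings_le[OF finV finL, where W = "{}"])
      show "X \<subseteq> V" using setsD[OF Xs] by simp
      have "card X ^ 2 \<le> r ^ 2" using setsD[OF Xs] by (intro power_mono) auto
      then show "2 * card X ^ 2 \<le> card L" using r by linarith
      show "c(x := d) \<in> colorings" if "c \<in> colorings" "x \<in> X - {}" "d \<in> L" for c x d
        using that setsD[OF Xs] by (auto simp: colorings_def PiE_def extensional_def)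
    qed (auto simp: colorings_def)
    moreover have "{c \<in> colorings. inj_on c X} \<subseteq> EN"
      using A X neg by (auto simp: approximates_def co_acc_def colorings_def)
    then have "card {c \<in> colorings. inj_on c X} \<le> card EN"
      using E(2) finite_colorings by (intro card_mono) (auto intro: finite_subset)
    moreover have "card colorings = card {c \<in> colorings. inj_on c X} + card {c \<in> colorings. \<not> inj_on c X}"
      using finite_colorings by (subst card_Un_disjoint[symmetric]) (auto intro: arg_cong[where f = card])
    ultimately have "card colorings \<le> 2 * card EN" by linarith
    then have "2 ^ p * card colorings \<le> 2 * (2 ^ p * card EN)" by simp
    also have "\<dots> \<le> (2 * s * card sets) * card colorings" using E(4) by simp
    finally have le: "2 ^ p * card colorings \<le> (2 * s * card sets) * card colorings" .
    have "2 ^ p \<le> 2 * s * card sets"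
    proof -
      have "L \<noteq> {}" using r by auto
      then have "0 < card colorings"
        using finV finL by (simp add: colorings_def card_PiE card_gt_0_iff)
      then show ?thesis using le by simp
    qed
    also have "\<dots> \<le> 2 * s * (card V + 1) ^ r"
      using card_subsets_card_le[OF finV] by (intro mult_le_mono2) (simp add: sets_def)
    finally show ?thesis ..
  qed
qed

end

section \<open>Asymptotics\<close>

text \<open>Used with \<open>a = 1/3 - \<epsilon>\<close>: the first summand bounds the exponent of
  \<open>(n + 1) ^ r\<close>, the second is the exponent to be reached, and the 3 pays 1 for
  rounding \<open>p\<close> and 2 for a factor 4.\<close>

lemma eventually_powr_third_dominates:
  fixes a :: real
  assumes "0 < a" and "a < 1/3"
  shows "\<forall>\<^sub>F n :: nat in sequentially.
    real n powr a * log 2 (real n + 1) + real n powr a / 16 + 3 \<le> real n powr (1/3) / 2"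
  using assms by real_asymp

lemma nat_floor_bounds:
  fixes x :: real
  assumes "0 \<le> x"
  shows "real (nat \<lfloor>x\<rfloor>) \<le> x" and "x - 1 \<le> real (nat \<lfloor>x\<rfloor>)"
  using assms by simp_all

text \<open>The conclusion has \<open>s / 2\<close> to leave room for modal circuits that are
  simulated with two gates per node.\<close>

lemma clique_color_separation_lower_bound:
  assumes "0 < \<epsilon>" and "\<epsilon> < 1/3"
  shows "\<forall>\<^sub>F n in sequentially. \<forall>s F f.
    mono_gates {1..n} s F \<longrightarrow> f \<in> F \<longrightarrow>
    (\<forall>Z. Z \<subseteq> {1..n} \<longrightarrow> card Z = clique_num n \<longrightarrow> f (clique_graph Z)) \<longrightarrow>
    (\<forall>c \<in> {1..n} \<rightarrow>\<^sub>E {1..color_num \<epsilon> n}. \<not> f (multipartite_graph c)) \<longrightarrow>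
    2 powr (real n powr (1/3 - \<epsilon>) / 16) \<le> real s / 2"
proof -
  define a where "a = 1/3 - \<epsilon>"
  have a: "0 < a" "a < 1/3" using assms by (auto simp: a_def)
  have "filterlim (\<lambda>n. real n powr a) at_top sequentially" using a by real_asymp
  \<comment> \<open>A generous value: with it \<open>r\<close> is at least 2, and y/16 + 3 is at
    most y/4 - 1/2 in the first case of the final bound.\<close>
  then have "\<forall>\<^sub>F n in sequentially. 40 \<le> real n powr a" by (simp add: filterlim_at_top)
  moreover note eventually_powr_third_dominates[OF a] eventually_ge_at_top[of "1::nat"]
  ultimately show ?thesis
  proof eventually_elim
    case (elim n)
    define y where "y = real n powr a"
    define k where "k = clique_num n"
    define l where "l = color_num \<epsilon> n"
    \<comment> \<open>\<open>r\<close> is the largest number with \<open>2 * r ^ 2 \<le> l\<close>,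
      and \<open>p\<close> the largest with \<open>2 * p * k \<le> n\<close>.\<close>
    define r where "r = nat \<lfloor>sqrt (real l / 2)\<rfloor>"
    define p where "p = n div (2 * k)"
    have y: "40 \<le> y" and n: "1 \<le> n"
      and dom: "y * log 2 (real n + 1) + y / 16 + 3 \<le> real n powr (1/3) / 2"
      using elim by (auto simp: y_def)
    have "real n powr (2/3 - 2 * \<epsilon>) = y ^ 2"
      using n by (simp add: y_def a_def power2_eq_square flip: powr_add)
    then have l: "real l \<le> y ^ 2" "y ^ 2 - 1 \<le> real l"
      using nat_floor_bounds[of "y ^ 2"] by (simp_all add: l_def color_num_def)
    have r_le: "real r \<le> sqrt (real l / 2)" and r_ge: "sqrt (real l / 2) - 1 \<le> real r"
      unfolding r_def by (simp_all add: nat_floor_bounds)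
    have "real r ^ 2 \<le> real l / 2"
      using r_le by (metis of_nat_0_le_iff power_mono real_sqrt_pow2 divide_nonneg_nonneg zero_le_numeral)
    then have "real (2 * r ^ 2) \<le> real l" by simp
    then have rl: "2 * r ^ 2 \<le> l" by linarith
    have "sqrt (real l / 2) \<le> sqrt (y ^ 2)" using l by (intro real_sqrt_le_mono) simp
    then have r_le_y: "real r \<le> y" using r_le y by simp
    have "sqrt ((y / 2) ^ 2) \<le> sqrt (real l / 2)"
    proof (intro real_sqrt_le_mono)
      have "40 * 40 \<le> y * y" using y by (intro mult_mono) auto
      then show "(y / 2) ^ 2 \<le> real l / 2" using l by (simp add: power2_eq_square)
    qed
    then have r_ge_y: "y / 2 - 1 \<le> real r" using r_ge y by simp
    have k_le: "real k \<le> real n powr (2/3)" and k1: "1 \<le> k"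
      using n ge_one_powr_ge_zero[of "real n" "2/3"]
      by (simp_all add: k_def clique_num_def nat_floor_bounds le_nat_iff)
    have kn: "k \<le> n"
    proof -
      have "real n powr (2/3) \<le> real n powr 1" using n by (intro powr_mono) auto
      then show ?thesis using k_le n by simp
    qed
    have "real n powr (1/3) / 2 \<le> real n / (2 * real k)"
    proof -
      have "real n powr (1/3) * real k \<le> real n powr (1/3) * real n powr (2/3)"
        using k_le by (intro mult_left_mono) auto
      also have "\<dots> = real n" using n by (simp flip: powr_add)
      finally show ?thesis using k1 by (simp add: field_simps)
    qed
    also have "\<dots> \<le> real p + 1"
    proof -
      have "n < 2 * k * (p + 1)"
        using k1 dividend_less_times_div[of "2 * k" n] by (simp add: p_def)
      then have "real n \<le> real (2 * k * (p + 1))" by linarith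
      then show ?thesis using k1 by (simp add: field_simps)
    qed
    finally have p_ge: "y * log 2 (real n + 1) + y / 16 + 2 \<le> real p" using dom by linarith
    have log0: "0 \<le> log 2 (real n + 1)" by simp
    have p2: "2 \<le> p"
    proof -
      have "0 \<le> y * log 2 (real n + 1)" using y log0 by simp
      then have "2 \<le> real p" using p_ge y by linarith
      then show ?thesis by simp
    qed
    have pk: "2 * p * k \<le> n" using div_times_less_eq_dividend[of n "2 * k"] by (simp add: p_def mult_ac)
    show ?case
    proof (intro allI impI)
      fix s F f
      assume *: "mono_gates {1..n} s F" "f \<in> F"
        "\<forall>Z. Z \<subseteq> {1..n} \<longrightarrow> card Z = clique_num n \<longrightarrow> f (clique_graph Z)"
        "\<forall>c\<in>{1..n} \<rightarrow>\<^sub>E {1..color_num \<epsilon> n}. \<not> f (multipartite_graph c)"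
      interpret clique_color_approximation "{1..n}" "{1..l}" k r p
        using k1 kn rl p2 pk r_ge_y y by unfold_locales auto
      have "2 ^ ((r + 1) div 2) \<le> 4 * s \<or> 2 ^ p \<le> 2 * s * (card {1..n} + 1) ^ r"
        using mono_gates_lower_bound[OF *(1,2)] *(3,4) by (auto simp: k_def l_def)
      then have "2 powr (y / 16) \<le> real s / 2"
      proof
        assume "2 ^ ((r + 1) div 2) \<le> 4 * s"
        then have s: "2 powr real ((r + 1) div 2) \<le> 4 * real s"
          by (simp add: powr_realpow) (metis of_nat_le_iff of_nat_mult of_nat_numeral of_nat_power)
        have "r \<le> 2 * ((r + 1) div 2)" by linarith
        \<comment> \<open>The 3 gives a factor 8, which turns the bound by \<open>4 * s\<close> into
          one by \<open>s / 2\<close>.\<close>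
        then have "y / 16 + 3 \<le> real ((r + 1) div 2)" using r_ge_y y by linarith
        then have "2 powr (y / 16 + 3) \<le> 2 powr real ((r + 1) div 2)" by simp
        with s show ?thesis by (simp add: powr_add)
      next
        assume "2 ^ p \<le> 2 * s * (card {1..n} + 1) ^ r"
        then have "real (2 ^ p) \<le> real (2 * s * (card {1..n} + 1) ^ r)" by (rule of_nat_mono)
        then have "2 powr real p \<le> 2 * real s * (real n + 1) ^ r"
          by (simp add: powr_realpow add.commute)
        also have "(real n + 1) ^ r = 2 powr (real r * log 2 (real n + 1))"
          by (simp add: powr_realpow[symmetric] powr_powr[symmetric] mult.commute[of "real r"])
        also have "\<dots> \<le> 2 powr (y * log 2 (real n + 1))"
          using r_le_y log0 by (simp add: mult_right_mono)
        finally have s: "2 powr real p \<le> 2 * real s * 2 powr (y * log 2 (real n + 1))"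
          by (simp add: mult_left_mono)
        have "2 powr (y * log 2 (real n + 1)) * (4 * 2 powr (y / 16)) = 2 powr (y * log 2 (real n + 1) + y / 16 + 2)"
          by (simp add: powr_add)
        also have "\<dots> \<le> 2 powr real p" using p_ge by simp
        also note s
        finally have "2 powr (y * log 2 (real n + 1)) * (4 * 2 powr (y / 16)) \<le>
            2 powr (y * log 2 (real n + 1)) * (2 * real s)" by (simp add: mult_ac)
        then show ?thesis by (subst (asm) mult_le_cancel_left_pos) auto
      qed
      then show "2 powr (real n powr (1/3 - \<epsilon>) / 16) \<le> real s / 2" by (simp add: y_def a_def)
    qed
  qed
qed

section \<open>Test valuations\<close>

lemma eval_bigand [simp]: "eval v (bigand As) \<longleftrightarrow> (\<forall>A\<in>set As. eval v A)"
  by (induction As) auto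

lemma eval_bigor [simp]: "eval v (bigor As) \<longleftrightarrow> (\<exists>A\<in>set As. eval v A)"
  by (induction As) auto

lemma set_edges: "set (edges n) = {(i, j). 1 \<le> i \<and> i < j \<and> j \<le> n}"
  by (auto simp: edges_def)

text \<open>Here q is the clique on \<open>Z\<close> and p its complement, so one of them is true at
  each edge; \<open>g\<close> enumerates the clique.\<close>

fun clique_val :: "nat set \<Rightarrow> (nat \<Rightarrow> nat) \<Rightarrow> atom \<Rightarrow> bool" where
  "clique_val Z g (P i j) = (\<not> clique_graph Z i j)"
| "clique_val Z g (Q i j) = clique_graph Z i j"
| "clique_val Z g (R u i) = (i = g u)"
| "clique_val Z g (S i a) = False"

fun color_val :: "(nat \<Rightarrow> nat) \<Rightarrow> atom \<Rightarrow> bool" where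
  "color_val c (P i j) = True"
| "color_val c (Q i j) = multipartite_graph c i j"
| "color_val c (R u i) = False"
| "color_val c (S i a) = (c i = a)"

text \<open>The guard on \<open>Q\<close> turns every atom into either an edge variable or a
  constant.\<close>

fun input_val :: "nat \<Rightarrow> (nat \<Rightarrow> nat \<Rightarrow> bool) \<Rightarrow> atom \<Rightarrow> bool" where
  "input_val n e (P i j) = True"
| "input_val n e (Q i j) = (i \<in> {1..n} \<and> j \<in> {1..n} \<and> i \<noteq> j \<and> e i j)"
| "input_val n e (R u i) = False"
| "input_val n e (S i a) = False"

lemma clique_val_pv_qv: "clique_val Z g (pv i j) \<longleftrightarrow> \<not> clique_val Z g (qv i j)"
  by (simp add: pv_def qv_def)

lemma not_clique_false:
  assumes "bij_betw g {1..clique_num n} Z" and "Z \<subseteq> {1..n}"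
  shows "\<not> eval (clique_val Z g) (not_clique n)"
proof -
  define K where "K = [1..<clique_num n + 1]"
  define V where "V = [1..<n + 1]"
  have K: "set K = {1..clique_num n}" and V: "set V = {1..n}"
    unfolding K_def V_def set_upt by auto
  have g: "g u \<in> Z" "g u \<in> set V" if "u \<in> set K" for u
    using bij_betw_apply[OF assms(1)] assms(2) that unfolding K V by blast+
  have inj: "u = u'" if "g u = g u'" "u \<in> set K" "u' \<in> set K" for u u'
    using inj_onD[OF bij_betw_imp_inj_on[OF assms(1)]] that unfolding K by blast
  have pv: "\<not> clique_val Z g (pv (g u) (g u'))" if "u \<in> set K" "u' \<in> set K" for u u'
    using g(1) that by (simp add: pv_def clique_graph_def min_def max_def)
  have "eval (clique_val Z g) (Clique n (\<lambda>i j. Neg (Atom (pv i j))) (\<lambda>u i. Atom (R u i)))"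
    unfolding Clique_def Let_def K_def[symmetric] V_def[symmetric] eval_bigand set_append ball_Un
    using g(2) inj pv by (intro conjI) auto
  then show ?thesis by (simp add: not_clique_def)
qed

lemma not_color_false:
  assumes "c \<in> {1..n} \<rightarrow>\<^sub>E {1..color_num \<epsilon> n}"
  shows "\<not> eval (color_val c) (not_color \<epsilon> n)"
proof -
  define K where "K = [1..<color_num \<epsilon> n + 1]"
  define V where "V = [1..<n + 1]"
  have K: "set K = {1..color_num \<epsilon> n}" and V: "set V = {1..n}"
    unfolding K_def V_def set_upt by auto
  have c: "c i \<in> set K" if "i \<in> set V" for i using assms that unfolding K V by blast
  have qv: "color_val c (qv i j) \<longleftrightarrow> c i \<noteq> c j" for i j
    by (auto simp: qv_def multipartite_graph_def min_def max_def)
  have "eval (color_val c) (Color \<epsilon> n (\<lambda>i j. Atom (qv i j)) (\<lambda>i a. Atom (S i a)))"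
    unfolding Color_def Let_def K_def[symmetric] V_def[symmetric] eval_bigand set_append ball_Un
    using c by (intro conjI) (auto simp: qv)
  then show ?thesis by (simp add: not_color_def)
qed

lemma input_val_le_color_val: "input_val n (multipartite_graph c) a \<Longrightarrow> color_val c a"
  by (cases a) auto

text \<open>All \<open>P\<close> atoms may be included because \<open>input_val\<close> makes them
  true. The \<open>Q\<close> atoms are restricted to edges: on a loop in \<open>Z\<close>,
  \<open>clique_val\<close> is true but \<open>input_val\<close> is false.\<close>

definition graph_atoms :: "nat \<Rightarrow> atom set" where
  "graph_atoms n = range (case_prod P) \<union> case_prod Q ` set (edges n)"

lemma clique_val_le_input_val:
  "a \<in> graph_atoms n \<Longrightarrow> clique_val Z g a \<Longrightarrow> input_val n (clique_graph Z) a"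
  by (auto simp: graph_atoms_def set_edges)

lemma edge_atoms: "(i, j) \<in> set (edges n) \<Longrightarrow> pv i j \<in> graph_atoms n \<and> qv i j \<in> graph_atoms n"
  by (auto simp: graph_atoms_def pv_def qv_def set_edges)

lemma atoms_bigand: "atoms (bigand As) = (\<Union>A\<in>set As. atoms A)"
  by (induction As) auto

lemma matoms_mbigand: "matoms (mbigand As) = (\<Union>A\<in>set As. matoms A)"
  by (induction As) auto

lemma atoms_premise: "atoms (premise n) \<subseteq> graph_atoms n"
  using edge_atoms by (force simp: premise_def atoms_bigand)

lemma matoms_mpremise: "matoms (mpremise n) \<subseteq> graph_atoms n"
  using edge_atoms by (force simp: mpremise_def matoms_mbigand)

lemma eval_premise: "eval (clique_val Z g) (premise n)"
  by (auto simp: premise_def clique_val_pv_qv)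

fun positive :: "form \<Rightarrow> bool" where
  "positive (And A B) = (positive A \<and> positive B)"
| "positive (Or A B) = (positive A \<and> positive B)"
| "positive (Imp A B) = False"
| "positive _ = True"

fun mpositive :: "mform \<Rightarrow> bool" where
  "mpositive (MAnd A B) = (mpositive A \<and> mpositive B)"
| "mpositive (MOr A B) = (mpositive A \<and> mpositive B)"
| "mpositive (MImp A B) = False"
| "mpositive (Box A) = mpositive A"
| "mpositive _ = True"

lemma eval_positive_mono:
  "positive A \<Longrightarrow> (\<And>a. a \<in> atoms A \<Longrightarrow> v a \<Longrightarrow> w a) \<Longrightarrow> eval v A \<Longrightarrow> eval w A"
  by (induction A) auto

section \<open>Superintuitionistic logics are classically sound\<close>

lemma ipc_weaken: "ipc B \<Longrightarrow> ipc (Imp A B)"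
  using ipc.intros(1,11) by blast

lemma ipc_S: "ipc (Imp A (Imp B C)) \<Longrightarrow> ipc (Imp A B) \<Longrightarrow> ipc (Imp A C)"
  using ipc.intros(2,11) by blast

lemma ipc_trans: "ipc (Imp A B) \<Longrightarrow> ipc (Imp B C) \<Longrightarrow> ipc (Imp A C)"
  using ipc_S ipc_weaken by blast

lemma ipc_refl: "ipc (Imp A A)"
  using ipc_S[OF ipc.intros(1) ipc.intros(1)] .

abbreviation const_subst :: "(atom \<Rightarrow> bool) \<Rightarrow> atom \<Rightarrow> form" where
  "const_subst v a \<equiv> if v a then Top else Bot"

text \<open>As in Kalmar's completeness proof: intuitionistic logic already proves or refutes every
  formula built from constants, in agreement with its classical value.\<close>

lemma ipc_const_subst:
  "if eval v A then ipc (subst (const_subst v) A) else ipc (Imp (subst (const_subst v) A) Bot)"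
proof (induction A)
  case (And A B)
  let ?A = "subst (const_subst v) A" and ?B = "subst (const_subst v) B"
  have "ipc (And ?A ?B)" if "ipc ?A" "ipc ?B"
    using that ipc.intros(5,11) by blast
  moreover have "ipc (Imp (And ?A ?B) Bot)" if "ipc (Imp ?A Bot) \<or> ipc (Imp ?B Bot)"
    using that ipc_trans[OF ipc.intros(3)] ipc_trans[OF ipc.intros(4)] by blast
  ultimately show ?case using And by (cases "eval v A"; cases "eval v B") simp_all
next
  case (Or A B)
  let ?A = "subst (const_subst v) A" and ?B = "subst (const_subst v) B"
  have "ipc (Or ?A ?B)" if "ipc ?A \<or> ipc ?B"
    using that ipc.intros(6,7,11) by blast
  moreover have "ipc (Imp (Or ?A ?B) Bot)" if "ipc (Imp ?A Bot)" "ipc (Imp ?B Bot)"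
    using ipc.intros(11)[OF ipc.intros(11)[OF ipc.intros(8) that(1)] that(2)] .
  ultimately show ?case using Or by (cases "eval v A"; cases "eval v B") simp_all
next
  case (Imp A B)
  let ?A = "subst (const_subst v) A" and ?B = "subst (const_subst v) B"
  show ?case
  proof (cases "eval v A \<and> \<not> eval v B")
    case True
    then have "ipc ?A" "ipc (Imp ?B Bot)" using Imp by simp_all
    then have "ipc (Imp (Imp ?A ?B) Bot)"
      using ipc_S[OF ipc_refl ipc_weaken] ipc_trans by blast
    then show ?thesis using True by simp
  next
    case False
    then have "ipc (Imp ?A ?B)"
      using Imp ipc_weaken[of ?B ?A] ipc_trans[OF _ ipc.intros(9), of ?A ?B]
      by (cases "eval v B") simp_all
    then show ?thesis using False by simp
  qed
qed (auto intro: ipc.intros ipc_refl)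

text \<open>If \<open>A\<close> were false under \<open>v\<close>, its constant instance and the
  refutation of that instance would both be in \<open>L\<close>.\<close>

lemma superintuitionistic_classically_sound:
  assumes "superintuitionistic L" and "Bot \<notin> L" and "A \<in> L"
  shows "eval v A"
proof (rule ccontr)
  assume "\<not> eval v A"
  then have "Imp (subst (const_subst v) A) Bot \<in> L"
    using ipc_const_subst[of v A] assms(1) by (simp add: superintuitionistic_def)
  moreover have "subst (const_subst v) A \<in> L" using assms by (simp add: superintuitionistic_def)
  ultimately show False using assms(1,2) unfolding superintuitionistic_def by blast
qed

section \<open>Circuits as monotone functions of a graph\<close>

lemma mono_gates_input:
  assumes "mono_gates {1..n} s F"
  shows "mono_gates {1..n} (Suc s) (insert (\<lambda>e. input_val n e a) F)"
proof (cases "\<exists>i j. a = Q i j \<and> i \<in> {1..n} \<and> j \<in> {1..n} \<and> i \<noteq> j")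
  case True
  then obtain i j where "a = Q i j" "i \<in> {1..n}" "j \<in> {1..n}" "i \<noteq> j" by auto
  then show ?thesis using mono_gates.edge[OF assms, of i j] by simp
next
  case False
  \<comment> \<open>The value does not depend on the graph, so it may be taken at any
    relation.\<close>
  then have "(\<lambda>e. input_val n e a) = (\<lambda>_. input_val n (\<lambda>_ _. True) a)"
    by (cases a) auto
  then show ?thesis using mono_gates.const[OF assms] by metis
qed

text \<open>This is what a box gate becomes: it repeats its input under \<open>triv_eval\<close>,
  and the end-point value of its input under \<open>chain_eval\<close>.\<close>

lemma mono_gates_copy: "mono_gates V s F \<Longrightarrow> f \<in> F \<Longrightarrow> mono_gates V (Suc s) (insert f F)"
  using mono_gates.conj[of V s F f f] by simp

abbreviation circuit_forms :: "gate list \<Rightarrow> form list" where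
  "circuit_forms \<equiv> foldl (\<lambda>As g. As @ [gate_form As g]) []"

abbreviation mcircuit_forms :: "mgate list \<Rightarrow> mform list" where
  "mcircuit_forms \<equiv> foldl (\<lambda>As g. As @ [mgate_form As g]) []"

lemma length_circuit_forms [simp]: "length (circuit_forms C) = length C"
  by (induction C rule: rev_induct) auto

lemma length_mcircuit_forms [simp]: "length (mcircuit_forms C) = length C"
  by (induction C rule: rev_induct) auto

lemma wf_gates_snoc:
  assumes "\<forall>m<length (C @ [g]). inp ((C @ [g]) ! m) \<subseteq> {..<m}"
  shows "\<forall>m<length C. inp (C ! m) \<subseteq> {..<m}" and "inp g \<subseteq> {..<length C}"
proof -
  have "inp (C ! m) \<subseteq> {..<m}" if "m < length C" for m
    using assms[rule_format, of m] that by (simp add: nth_append)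
  then show "\<forall>m<length C. inp (C ! m) \<subseteq> {..<m}" by blast
  show "inp g \<subseteq> {..<length C}" using assms[rule_format, of "length C"] by simp
qed

lemma mono_gates_circuit:
  assumes "\<forall>m<length C. gate_inputs (C ! m) \<subseteq> {..<m}"
  shows "(\<forall>A\<in>set (circuit_forms C). positive A) \<and>
    mono_gates {1..n} (length C) ((\<lambda>A e. eval (input_val n e) A) ` set (circuit_forms C))"
  using assms
proof (induction C rule: rev_induct)
  case Nil
  show ?case by (simp add: mono_gates.empty)
next
  case (snoc g C)
  note wf = wf_gates_snoc[OF snoc.prems]
  define As where "As = circuit_forms C"
  define F where "F = (\<lambda>A e. eval (input_val n e) A) ` set As"
  have pos: "\<forall>A\<in>set As. positive A" and F: "mono_gates {1..n} (length C) F"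
    using snoc.IH[OF wf(1)] by (auto simp: As_def F_def)
  have As: "As ! i \<in> set As" if "i \<in> gate_inputs g" for i
    using wf(2) that by (auto simp: As_def)
  then have AsF: "(\<lambda>e. eval (input_val n e) (As ! i)) \<in> F" if "i \<in> gate_inputs g" for i
    using that by (auto simp: F_def)
  have "positive (gate_form As g)" using As pos by (cases g) auto
  moreover have "mono_gates {1..n} (Suc (length C)) (insert (\<lambda>e. eval (input_val n e) (gate_form As g)) F)"
    using F AsF mono_gates_input[OF F] mono_gates.const[OF F] mono_gates.conj[OF F] mono_gates.disj[OF F]
    by (cases g) auto
  ultimately show ?case using pos by (simp add: As_def F_def)
qed

section \<open>Modal circuits on one reflexive point and on a two-point chain\<close>

fun triv_eval :: "(atom \<Rightarrow> bool) \<Rightarrow> mform \<Rightarrow> bool" where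
  "triv_eval v (MAtom a) = v a"
| "triv_eval v MBot = False"
| "triv_eval v MTop = True"
| "triv_eval v (MAnd A B) = (triv_eval v A \<and> triv_eval v B)"
| "triv_eval v (MOr A B) = (triv_eval v A \<or> triv_eval v B)"
| "triv_eval v (MImp A B) = (triv_eval v A \<longrightarrow> triv_eval v B)"
| "triv_eval v (Box A) = triv_eval v A"

text \<open>Truth at the root of the irreflexive two-point chain; \<open>ver_eval\<close> is truth at its end point.\<close>

fun chain_eval :: "(atom \<Rightarrow> bool) \<Rightarrow> mform \<Rightarrow> bool" where
  "chain_eval v (MAtom a) = v a"
| "chain_eval v MBot = False"
| "chain_eval v MTop = True"
| "chain_eval v (MAnd A B) = (chain_eval v A \<and> chain_eval v B)"
| "chain_eval v (MOr A B) = (chain_eval v A \<or> chain_eval v B)"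
| "chain_eval v (MImp A B) = (chain_eval v A \<longrightarrow> chain_eval v B)"
| "chain_eval v (Box A) = ver_eval v A"

lemma triv_eval_mono:
  "mpositive A \<Longrightarrow> (\<And>a. a \<in> matoms A \<Longrightarrow> v a \<Longrightarrow> w a) \<Longrightarrow> triv_eval v A \<Longrightarrow> triv_eval w A"
  by (induction A) auto

lemma ver_eval_mono:
  "mpositive A \<Longrightarrow> (\<And>a. a \<in> matoms A \<Longrightarrow> v a \<Longrightarrow> w a) \<Longrightarrow> ver_eval v A \<Longrightarrow> ver_eval w A"
  by (induction A) auto

lemma chain_eval_mono:
  "mpositive A \<Longrightarrow> (\<And>a. a \<in> matoms A \<Longrightarrow> v a \<Longrightarrow> w a) \<Longrightarrow> chain_eval v A \<Longrightarrow> chain_eval w A"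
  by (induction A) (auto intro: ver_eval_mono)

lemma mpositive_mcircuit:
  assumes "\<forall>m<length C. mgate_inputs (C ! m) \<subseteq> {..<m}"
  shows "\<forall>A\<in>set (mcircuit_forms C). mpositive A"
  using assms
proof (induction C rule: rev_induct)
  case (snoc g C)
  note wf = wf_gates_snoc[OF snoc.prems]
  have pos: "\<forall>A\<in>set (mcircuit_forms C). mpositive A" using snoc.IH[OF wf(1)] .
  moreover have "mcircuit_forms C ! i \<in> set (mcircuit_forms C)" if "i \<in> mgate_inputs g" for i
    using wf(2) that by auto
  ultimately have "mpositive (mgate_form (mcircuit_forms C) g)" by (cases g) auto
  then show ?case using pos by simp
qed simp

lemma mono_gates_mcircuit_triv:
  assumes "\<forall>m<length C. mgate_inputs (C ! m) \<subseteq> {..<m}"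
  shows "mono_gates {1..n} (length C) ((\<lambda>A e. triv_eval (input_val n e) A) ` set (mcircuit_forms C))"
  using assms
proof (induction C rule: rev_induct)
  case Nil
  show ?case by (simp add: mono_gates.empty)
next
  case (snoc g C)
  note wf = wf_gates_snoc[OF snoc.prems]
  define As where "As = mcircuit_forms C"
  define F where "F = (\<lambda>A e. triv_eval (input_val n e) A) ` set As"
  have F: "mono_gates {1..n} (length C) F"
    using snoc.IH[OF wf(1)] by (simp add: As_def F_def)
  have AsF: "(\<lambda>e. triv_eval (input_val n e) (As ! i)) \<in> F" if "i \<in> mgate_inputs g" for i
  proof -
    have "As ! i \<in> set As" using wf(2) that by (auto simp: As_def)
    then show ?thesis by (simp add: F_def)
  qed
  have "mono_gates {1..n} (Suc (length C)) (insert (\<lambda>e. triv_eval (input_val n e) (mgate_form As g)) F)"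
    using F AsF mono_gates_input[OF F] mono_gates.const[OF F] mono_gates.conj[OF F]
      mono_gates.disj[OF F] mono_gates_copy[OF F]
    by (cases g) auto
  then show ?case by (simp add: As_def F_def)
qed

text \<open>Each node contributes its values at the end point and at the root, because a box at the
  root reads the end point.\<close>

lemma mono_gates_mcircuit_chain:
  assumes "\<forall>m<length C. mgate_inputs (C ! m) \<subseteq> {..<m}"
  shows "mono_gates {1..n} (2 * length C)
    ((\<lambda>A e. ver_eval (input_val n e) A) ` set (mcircuit_forms C) \<union>
     (\<lambda>A e. chain_eval (input_val n e) A) ` set (mcircuit_forms C))"
  using assms
proof (induction C rule: rev_induct)
  case Nil
  show ?case by (simp add: mono_gates.empty)
next
  case (snoc g C)
  note wf = wf_gates_snoc[OF snoc.prems]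
  define As where "As = mcircuit_forms C"
  define F where "F = (\<lambda>A e. ver_eval (input_val n e) A) ` set As \<union>
    (\<lambda>A e. chain_eval (input_val n e) A) ` set As"
  have F: "mono_gates {1..n} (2 * length C) F"
    using snoc.IH[OF wf(1)] by (simp add: As_def F_def)
  have AsF: "(\<lambda>e. ver_eval (input_val n e) (As ! i)) \<in> F"
    "(\<lambda>e. chain_eval (input_val n e) (As ! i)) \<in> F" if "i \<in> mgate_inputs g" for i
  proof -
    have "As ! i \<in> set As" using wf(2) that by (auto simp: As_def)
    then show "(\<lambda>e. ver_eval (input_val n e) (As ! i)) \<in> F"
      "(\<lambda>e. chain_eval (input_val n e) (As ! i)) \<in> F" by (simp_all add: F_def)
  qed
  define G where "G = insert (\<lambda>e. ver_eval (input_val n e) (mgate_form As g)) F"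
  have G: "mono_gates {1..n} (Suc (2 * length C)) G"
    using AsF mono_gates_input[OF F] mono_gates.const[OF F] mono_gates.conj[OF F] mono_gates.disj[OF F]
    unfolding G_def by (cases g) auto
  have AsG: "(\<lambda>e. ver_eval (input_val n e) (As ! i)) \<in> G"
    "(\<lambda>e. chain_eval (input_val n e) (As ! i)) \<in> G" if "i \<in> mgate_inputs g" for i
    using AsF[OF that] by (simp_all add: G_def)
  have "mono_gates {1..n} (Suc (Suc (2 * length C)))
      (insert (\<lambda>e. chain_eval (input_val n e) (mgate_form As g)) G)"
    using AsG mono_gates_input[OF G] mono_gates.const[OF G] mono_gates.conj[OF G]
      mono_gates.disj[OF G] mono_gates_copy[OF G]
    by (cases g) auto
  then show ?case by (simp add: As_def F_def G_def insert_commute)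
qed

section \<open>Variable-free positive formulas in normal modal logics\<close>

abbreviation mconst_subst :: "(atom \<Rightarrow> bool) \<Rightarrow> atom \<Rightarrow> mform" where
  "mconst_subst v a \<equiv> if v a then MTop else MBot"

lemma msubst_emb: "msubst (mconst_subst v) (emb A) = emb (subst (const_subst v) A)"
  by (induction A) auto

lemma eval_const_subst: "eval w (subst (const_subst v) A) = eval v A"
  by (induction A) auto

locale normal_modal_logic =
  fixes L :: "mform set"
  assumes normal: "normal_modal L"
begin

definition le :: "mform \<Rightarrow> mform \<Rightarrow> bool"  (infix "\<preceq>" 50) where
  "X \<preceq> Y \<longleftrightarrow> MImp X Y \<in> L"

lemma mp: "X \<preceq> Y \<Longrightarrow> X \<in> L \<Longrightarrow> Y \<in> L"
  using normal unfolding normal_modal_def le_def by blast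

lemma mp2: "MImp X (MImp Y Z) \<in> L \<Longrightarrow> X \<in> L \<Longrightarrow> Y \<in> L \<Longrightarrow> Z \<in> L"
  using mp unfolding le_def by blast

lemma nec: "X \<in> L \<Longrightarrow> Box X \<in> L"
  using normal unfolding normal_modal_def by blast

lemma msubst_closed: "X \<in> L \<Longrightarrow> msubst \<sigma> X \<in> L"
  using normal unfolding normal_modal_def by blast

lemma taut: "(\<And>v. eval v A) \<Longrightarrow> msubst \<sigma> (emb A) \<in> L"
  using normal msubst_closed unfolding normal_modal_def by blast

text \<open>The atoms \<open>P 0 0\<close>, \<open>P 0 1\<close> and \<open>P 0 2\<close> act as
  schematic letters for \<open>X\<close>, \<open>Y\<close> and \<open>Z\<close>.\<close>

lemma taut3:
  assumes "\<And>v. eval v A"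
  shows "msubst (\<lambda>a. if a = P 0 0 then X else if a = P 0 1 then Y else Z) (emb A) \<in> L"
  using taut[OF assms] .

lemma top: "MTop \<in> L"
  using taut[of Top] by simp

lemma bot_le: "MBot \<preceq> X"
  using taut3[of "Imp Bot (Atom (P 0 0))" X] by (simp add: le_def)

lemma le_of_mem: "Y \<in> L \<Longrightarrow> X \<preceq> Y"
  using taut3[of "Imp (Atom (P 0 0)) (Imp (Atom (P 0 1)) (Atom (P 0 0)))" Y X] mp
  by (simp add: le_def)

lemma refl: "X \<preceq> X"
  using taut3[of "Imp (Atom (P 0 0)) (Atom (P 0 0))" X] by (simp add: le_def)

lemma trans: "X \<preceq> Y \<Longrightarrow> Y \<preceq> Z \<Longrightarrow> X \<preceq> Z"
  using taut3[of "Imp (Imp (Atom (P 0 0)) (Atom (P 0 1)))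
      (Imp (Imp (Atom (P 0 1)) (Atom (P 0 2))) (Imp (Atom (P 0 0)) (Atom (P 0 2))))" X Y Z]
    mp2[of "MImp X Y" "MImp Y Z" "MImp X Z"]
  by (simp add: le_def)

lemma conj_le1: "X \<preceq> Z \<Longrightarrow> MAnd X Y \<preceq> Z"
  using taut3[of "Imp (And (Atom (P 0 0)) (Atom (P 0 1))) (Atom (P 0 0))" X Y] trans
  by (simp add: le_def)

lemma conj_le2: "Y \<preceq> Z \<Longrightarrow> MAnd X Y \<preceq> Z"
  using taut3[of "Imp (And (Atom (P 0 0)) (Atom (P 0 1))) (Atom (P 0 1))" X Y] trans
  by (simp add: le_def)

lemma le_conj: "Z \<preceq> X \<Longrightarrow> Z \<preceq> Y \<Longrightarrow> Z \<preceq> MAnd X Y"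
  using taut3[of "Imp (Imp (Atom (P 0 2)) (Atom (P 0 0))) (Imp (Imp (Atom (P 0 2)) (Atom (P 0 1)))
      (Imp (Atom (P 0 2)) (And (Atom (P 0 0)) (Atom (P 0 1)))))" X Y Z]
    mp2[of "MImp Z X" "MImp Z Y" "MImp Z (MAnd X Y)"]
  by (simp add: le_def)

lemma le_disj1: "Z \<preceq> X \<Longrightarrow> Z \<preceq> MOr X Y"
  using taut3[of "Imp (Atom (P 0 0)) (Or (Atom (P 0 0)) (Atom (P 0 1)))" X Y] trans
  by (simp add: le_def)

lemma le_disj2: "Z \<preceq> Y \<Longrightarrow> Z \<preceq> MOr X Y"
  using taut3[of "Imp (Atom (P 0 1)) (Or (Atom (P 0 0)) (Atom (P 0 1)))" X Y] trans
  by (simp add: le_def)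

lemma disj_le: "X \<preceq> Z \<Longrightarrow> Y \<preceq> Z \<Longrightarrow> MOr X Y \<preceq> Z"
  using taut3[of "Imp (Imp (Atom (P 0 0)) (Atom (P 0 2))) (Imp (Imp (Atom (P 0 1)) (Atom (P 0 2)))
      (Imp (Or (Atom (P 0 0)) (Atom (P 0 1))) (Atom (P 0 2))))" X Y Z]
    mp2[of "MImp X Z" "MImp Y Z" "MImp (MOr X Y) Z"]
  by (simp add: le_def)

lemma box_mono: "X \<preceq> Y \<Longrightarrow> Box X \<preceq> Box Y"
proof -
  assume "X \<preceq> Y"
  then have "Box (MImp X Y) \<in> L" by (simp add: le_def nec)
  moreover have "Box (MImp X Y) \<preceq> MImp (Box X) (Box Y)"
    using normal unfolding normal_modal_def le_def by blast
  ultimately show ?thesis using mp by (simp add: le_def)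
qed

lemma mem_iff_top_le: "X \<in> L \<longleftrightarrow> MTop \<preceq> X"
  using le_of_mem mp top by blast

text \<open>The first hypothesis keeps formulas below \<open>Box MBot\<close> there when a box is
  applied, and necessitation keeps theorems theorems. So a box never changes sides.\<close>

lemma triv_eval_bounds:
  assumes "Box (Box MBot) \<preceq> Box MBot" and "mpositive A"
  shows "if triv_eval v A then MTop \<preceq> msubst (mconst_subst v) A
    else msubst (mconst_subst v) A \<preceq> Box MBot"
  using assms(2)
proof (induction A)
  case (Box A)
  show ?case
  proof (cases "triv_eval v A")
    case True
    then show ?thesis using Box nec mem_iff_top_le by simp
  next
    case False
    then have "msubst (mconst_subst v) A \<preceq> Box MBot" using Box by simp
    then show ?thesis using False trans[OF box_mono assms(1)] by simp
  qed
qed (auto simp: refl bot_le split: if_splits intro: conj_le1 conj_le2 le_conj le_disj1 le_disj2 disj_le)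

text \<open>Any boxed formula lies above \<open>Box MBot\<close> by monotonicity, which matches its
  truth at the end point.\<close>

lemma ver_eval_bounds:
  assumes "mpositive A"
  shows "if ver_eval v A then Box MBot \<preceq> msubst (mconst_subst v) A
    else msubst (mconst_subst v) A \<preceq> MBot"
  using assms
  by (induction A)
    (auto simp: refl bot_le top le_of_mem box_mono split: if_splits
      intro: conj_le1 conj_le2 le_conj le_disj1 le_disj2 disj_le)

text \<open>In the case of a box, both alternatives of \<open>ver_eval_bounds\<close> are
  boxed.\<close>

lemma chain_eval_bounds:
  assumes "mpositive A"
  shows "if chain_eval v A then Box (Box MBot) \<preceq> msubst (mconst_subst v) A
    else msubst (mconst_subst v) A \<preceq> Box MBot"
  using assms
proof (induction A)
  case (Box A)
  then show ?case using ver_eval_bounds[of A v] by (auto simp: box_mono split: if_splits)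
qed (auto simp: refl bot_le top le_of_mem box_mono split: if_splits
      intro: conj_le1 conj_le2 le_conj le_disj1 le_disj2 disj_le)

text \<open>The threshold is \<open>Box MBot\<close> because a boxed propositional formula drops
  below it as soon as a valuation falsifies the formula, see \<open>box_emb_le\<close>.\<close>

definition detects :: "((atom \<Rightarrow> bool) \<Rightarrow> mform \<Rightarrow> bool) \<Rightarrow> bool" where
  "detects E \<longleftrightarrow> (\<forall>v A. mpositive A \<longrightarrow> (E v A \<longleftrightarrow> \<not> msubst (mconst_subst v) A \<preceq> Box MBot))"

text \<open>
  A variable-free positive formula is equivalent to \<open>\<top>\<close> or to some \<open>\<box>\<^sup>m\<bottom>\<close>, and these form a chain.
  Whether it lies strictly above \<open>\<box>\<bottom>\<close> is computed by erasing boxes if \<open>\<box>\<box>\<bottom> \<rightarrow> \<box>\<bottom>\<close> is in the logic,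
  and on the irreflexive two-point chain otherwise.
\<close>

lemma detects_cases:
  assumes "Box MBot \<notin> L"
  shows "detects triv_eval \<or> detects chain_eval"
proof (cases "Box (Box MBot) \<preceq> Box MBot")
  case True
  \<comment> \<open>This makes the two alternatives of \<open>triv_eval_bounds\<close> exclusive.
    For \<open>chain_eval_bounds\<close> the negated case assumption does the same.\<close>
  have "\<not> MTop \<preceq> Box MBot" using assms mem_iff_top_le by blast
  then have "detects triv_eval"
    unfolding detects_def using triv_eval_bounds[OF True] trans by (smt (verit))
  then show ?thesis ..
next
  case False
  then have "detects chain_eval"
    unfolding detects_def using chain_eval_bounds trans by (smt (verit))
  then show ?thesis ..
qed

lemma box_emb_le:
  assumes "\<not> eval v A"
  shows "msubst (mconst_subst v) (Box (emb A)) \<preceq> Box MBot"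
proof -
  \<comment> \<open>The constant instance is classically false under every valuation, so its
    negation is a tautology; the substitution by \<open>MAtom\<close> is the identity.\<close>
  have "msubst MAtom (emb (Imp (subst (const_subst v) A) Bot)) \<in> L"
    using assms by (intro taut) (simp add: eval_const_subst)
  moreover have "msubst MAtom B = B" for B by (induction B) auto
  ultimately have "msubst (mconst_subst v) (emb A) \<preceq> MBot" by (simp add: le_def msubst_emb)
  then show ?thesis using box_mono by simp
qed

lemma mbigand_mem: "(\<And>A. A \<in> set As \<Longrightarrow> msubst \<sigma> A \<in> L) \<Longrightarrow> msubst \<sigma> (mbigand As) \<in> L"
  by (induction As) (auto simp: mem_iff_top_le refl intro: le_conj)

lemma mpremise_mem: "msubst (mconst_subst (clique_val Z g)) (mpremise n) \<in> L"
proof -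
  have "Box MTop \<in> L" using top nec by blast
  then show ?thesis
    unfolding mpremise_def
    by (intro mbigand_mem) (auto simp: mem_iff_top_le clique_val_pv_qv intro: le_disj1 le_disj2)
qed

text \<open>On a clique \<open>I\<close> lies below \<open>Box MBot\<close>. If \<open>J\<close> did
  too, the theorem \<open>MOr I J\<close> would put \<open>Box MBot\<close> into \<open>L\<close>.
  On a colouring \<open>J\<close> itself lies below \<open>Box MBot\<close>.\<close>

lemma MDI_separates:
  assumes "Box MBot \<notin> L" and "detects E"
    and "is_MDI L (mpremise n) (emb (not_clique n)) (emb (not_color \<epsilon> n)) (I, J)"
    and "mpositive J"
  shows "bij_betw g {1..clique_num n} Z \<Longrightarrow> Z \<subseteq> {1..n} \<Longrightarrow> E (clique_val Z g) J"
    and "c \<in> {1..n} \<rightarrow>\<^sub>E {1..color_num \<epsilon> n} \<Longrightarrow> \<not> E (color_val c) J"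
proof -
  have MDI: "MImp (mpremise n) (MOr I J) \<in> L" "MImp I (Box (emb (not_clique n))) \<in> L"
      "MImp J (Box (emb (not_color \<epsilon> n))) \<in> L"
    using assms(3) by (auto simp: is_MDI_def)
  have sub: "msubst \<sigma> X \<preceq> msubst \<sigma> Y" if "MImp X Y \<in> L" for \<sigma> X Y
    using msubst_closed[OF that, of \<sigma>] by (simp add: le_def)
  {
    assume Z: "bij_betw g {1..clique_num n} Z" "Z \<subseteq> {1..n}"
    let ?s = "msubst (mconst_subst (clique_val Z g))"
    have "MOr (?s I) (?s J) \<in> L" using mp[OF sub[OF MDI(1)] mpremise_mem] by simp
    moreover have "?s I \<preceq> Box MBot"
      using trans[OF sub[OF MDI(2)] box_emb_le[OF not_clique_false[OF Z]]] .
    ultimately have "\<not> ?s J \<preceq> Box MBot" using disj_le mp assms(1) by blast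
    then show "E (clique_val Z g) J" using assms(2,4) by (simp add: detects_def)
  }
  assume "c \<in> {1..n} \<rightarrow>\<^sub>E {1..color_num \<epsilon> n}"
  then have "msubst (mconst_subst (color_val c)) J \<preceq> Box MBot"
    using trans[OF sub[OF MDI(3)] box_emb_le[OF not_color_false]] by blast
  then show "\<not> E (color_val c) J" using assms(2,4) by (simp add: detects_def)
qed

end

section \<open>The lower bound\<close>

text \<open>On a clique the premise is true and \<open>not_clique\<close> false, so \<open>I\<close>
  fails and \<open>J\<close> holds. On a colouring \<open>not_color\<close> is false, and with it
  \<open>J\<close>.\<close>

lemma PDI_separates:
  assumes "superintuitionistic L" and "Bot \<notin> L"
    and "is_PDI L (premise n) (not_clique n) (not_color \<epsilon> n) (I, J)"
  shows "bij_betw g {1..clique_num n} Z \<Longrightarrow> Z \<subseteq> {1..n} \<Longrightarrow> eval (clique_val Z g) J"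
    and "c \<in> {1..n} \<rightarrow>\<^sub>E {1..color_num \<epsilon> n} \<Longrightarrow> \<not> eval (color_val c) J"
proof -
  have PDI: "eval v (Imp (premise n) (Or I J))" "eval v (Imp I (not_clique n))"
    "eval v (Imp J (not_color \<epsilon> n))" for v
    by (rule superintuitionistic_classically_sound[OF assms(1,2)];
        use assms(3) in \<open>simp add: is_PDI_def\<close>)+
  show "eval (clique_val Z g) J" if "bij_betw g {1..clique_num n} Z" "Z \<subseteq> {1..n}"
    using PDI(1,2)[of "clique_val Z g"] eval_premise not_clique_false[OF that] by simp
  show "\<not> eval (color_val c) J" if "c \<in> {1..n} \<rightarrow>\<^sub>E {1..color_num \<epsilon> n}"
    using PDI(3)[of "color_val c"] not_color_false[OF that] by simp
qed

text \<open>
  Setting \<open>p\<close> to \<open>\<top>\<close> only raises the value on cliques, and \<open>color_val\<close> already has \<open>p = \<top>\<close>.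
\<close>

lemma separating_function_large:
  fixes eva :: "(atom \<Rightarrow> bool) \<Rightarrow> bool"
  assumes large: "\<forall>s F f. mono_gates {1..n} s F \<longrightarrow> f \<in> F \<longrightarrow>
      (\<forall>Z. Z \<subseteq> {1..n} \<longrightarrow> card Z = clique_num n \<longrightarrow> f (clique_graph Z)) \<longrightarrow>
      (\<forall>c \<in> {1..n} \<rightarrow>\<^sub>E {1..color_num \<epsilon> n}. \<not> f (multipartite_graph c)) \<longrightarrow> b \<le> real s / 2"
    and "mono_gates {1..n} s F" and "(\<lambda>e. eva (input_val n e)) \<in> F"
    and mono: "\<And>v w. (\<And>a. a \<in> graph_atoms n \<Longrightarrow> v a \<Longrightarrow> w a) \<Longrightarrow> eva v \<Longrightarrow> eva w"
    and pos: "\<And>Z g. bij_betw g {1..clique_num n} Z \<Longrightarrow> Z \<subseteq> {1..n} \<Longrightarrow> eva (clique_val Z g)"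
    and neg: "\<And>c. c \<in> {1..n} \<rightarrow>\<^sub>E {1..color_num \<epsilon> n} \<Longrightarrow> \<not> eva (color_val c)"
  shows "b \<le> real s / 2"
proof (rule large[rule_format, OF assms(2,3)])
  fix Z assume Z: "Z \<subseteq> {1..n}" "card Z = clique_num n"
  then have "card {1..clique_num n} = card Z" "finite Z" by (auto intro: finite_subset)
  then obtain g where "bij_betw g {1..clique_num n} Z"
    using finite_same_card_bij by blast
  then have "eva (clique_val Z g)" using pos Z(1) by blast
  then show "eva (input_val n (clique_graph Z))"
    by (rule mono[rotated]) (rule clique_val_le_input_val)
next
  fix c assume "c \<in> {1..n} \<rightarrow>\<^sub>E {1..color_num \<epsilon> n}"
  then have "\<not> eva (color_val c)" by (rule neg)
  then show "\<not> eva (input_val n (multipartite_graph c))"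
    using mono[of "input_val n (multipartite_graph c)" "color_val c"] input_val_le_color_val by metis
qed

lemma last_mem_circuit_forms: "C \<noteq> [] \<Longrightarrow> last (circuit_forms C) \<in> set (circuit_forms C)"
  using length_circuit_forms[of C]
  by (intro last_in_set notI) (simp del: length_circuit_forms)

lemma last_mem_mcircuit_forms: "C \<noteq> [] \<Longrightarrow> last (mcircuit_forms C) \<in> set (mcircuit_forms C)"
  using length_mcircuit_forms[of C]
  by (intro last_in_set notI) (simp del: length_mcircuit_forms)

text \<open>Excluding \<open>Box MBot\<close> from \<open>L2\<close> rules out the logic of
  \<open>verum_constant_MDI\<close>, where constant circuits interpolate.\<close>

theorem theorem5p15:
  fixes \<epsilon> :: real and L1 :: "form set" and L2 :: "mform set"
  assumes "0 < \<epsilon>" and "\<epsilon> < 1/3"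
    and "superintuitionistic L1" and "Bot \<notin> L1"
    and "normal_modal L2" and "MBot \<notin> L2" and "Box MBot \<notin> L2"
  shows "(\<forall>(C :: nat \<Rightarrow> gate list) (D :: nat \<Rightarrow> gate list) n0.
           (\<forall>n\<ge>n0. computes_PDI L1 \<epsilon> n (C n) (D n)) \<longrightarrow>
           (\<exists>c>0. \<forall>\<^sub>F n in sequentially.
              2 powr (c * real n powr (1/3 - \<epsilon>)) \<le> real (circuit_size (D n))))
       \<and> (\<forall>(C :: nat \<Rightarrow> mgate list) (D :: nat \<Rightarrow> mgate list) n0.
           (\<forall>n\<ge>n0. computes_MDI L2 \<epsilon> n (C n) (D n)) \<longrightarrow>
           (\<exists>c>0. \<forall>\<^sub>F n in sequentially.
              2 powr (c * real n powr (1/3 - \<epsilon>)) \<le> real (circuit_size (D n))))"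
proof (intro conjI allI impI)
  fix C D :: "nat \<Rightarrow> gate list" and n0
  assume PDI: "\<forall>n\<ge>n0. computes_PDI L1 \<epsilon> n (C n) (D n)"
  have "\<forall>\<^sub>F n in sequentially. 2 powr (1/16 * real n powr (1/3 - \<epsilon>)) \<le> real (circuit_size (D n))"
    using clique_color_separation_lower_bound[OF assms(1,2)] eventually_ge_at_top[of n0]
  proof eventually_elim
    case (elim n)
    let ?J = "unfold_circuit (D n)"
    have D: "D n \<noteq> []" "\<forall>m<length (D n). gate_inputs (D n ! m) \<subseteq> {..<m}"
      and J: "is_PDI L1 (premise n) (not_clique n) (not_color \<epsilon> n) (unfold_circuit (C n), ?J)"
      using PDI elim(2) by (auto simp: computes_PDI_def monotone_circuit_def)
    have mem: "?J \<in> set (circuit_forms (D n))"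
      using last_mem_circuit_forms[OF D(1)] by (simp add: unfold_circuit_def)
    have at: "atoms ?J \<subseteq> graph_atoms n"
      using J atoms_premise[of n] unfolding is_PDI_def by blast
    have "2 powr (real n powr (1/3 - \<epsilon>) / 16) \<le> real (length (D n)) / 2"
    proof (rule separating_function_large[where eva = "\<lambda>v. eval v ?J", OF elim(1)])
      show "mono_gates {1..n} (length (D n)) ((\<lambda>A e. eval (input_val n e) A) ` set (circuit_forms (D n)))"
        using mono_gates_circuit[OF D(2)] by blast
      show "(\<lambda>e. eval (input_val n e) ?J) \<in> (\<lambda>A e. eval (input_val n e) A) ` set (circuit_forms (D n))"
        using mem by (rule imageI)
      have "positive ?J" using mono_gates_circuit[OF D(2)] mem by blast
      then show "eval w ?J" if "\<And>a. a \<in> graph_atoms n \<Longrightarrow> v a \<Longrightarrow> w a" "eval v ?J" for v w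
        using at that by (intro eval_positive_mono[of ?J v w]) auto
    qed (use PDI_separates[OF assms(3,4) J] in blast)+
    then show ?case by (simp add: circuit_size_def)
  qed
  then show "\<exists>c>0. \<forall>\<^sub>F n in sequentially. 2 powr (c * real n powr (1/3 - \<epsilon>)) \<le> real (circuit_size (D n))"
    by (intro exI[of _ "1/16"]) simp
next
  fix C D :: "nat \<Rightarrow> mgate list" and n0
  assume MDI: "\<forall>n\<ge>n0. computes_MDI L2 \<epsilon> n (C n) (D n)"
  interpret normal_modal_logic L2 using assms(5) by unfold_locales
  have "\<forall>\<^sub>F n in sequentially. 2 powr (1/16 * real n powr (1/3 - \<epsilon>)) \<le> real (circuit_size (D n))"
    using clique_color_separation_lower_bound[OF assms(1,2)] eventually_ge_at_top[of n0]
  proof eventually_elim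
    case (elim n)
    let ?I = "unfold_mcircuit (C n)" and ?J = "unfold_mcircuit (D n)"
    have D: "D n \<noteq> []" "\<forall>m<length (D n). mgate_inputs (D n ! m) \<subseteq> {..<m}"
      and J: "is_MDI L2 (mpremise n) (emb (not_clique n)) (emb (not_color \<epsilon> n)) (?I, ?J)"
      using MDI elim(2) by (auto simp: computes_MDI_def monotone_mcircuit_def)
    have mem: "?J \<in> set (mcircuit_forms (D n))"
      using last_mem_mcircuit_forms[OF D(1)] by (simp add: unfold_mcircuit_def)
    then have pos: "mpositive ?J"
      using mpositive_mcircuit D(2) by blast
    have at: "matoms ?J \<subseteq> graph_atoms n"
      using J matoms_mpremise[of n] unfolding is_MDI_def by blast
    from detects_cases[OF assms(7)] have "2 powr (real n powr (1/3 - \<epsilon>) / 16) \<le> real (length (D n))"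
    proof
      assume det: "detects triv_eval"
      have "2 powr (real n powr (1/3 - \<epsilon>) / 16) \<le> real (length (D n)) / 2"
      proof (rule separating_function_large[where eva = "\<lambda>v. triv_eval v ?J",
            OF elim(1) mono_gates_mcircuit_triv[OF D(2)]])
        show "(\<lambda>e. triv_eval (input_val n e) ?J) \<in> (\<lambda>A e. triv_eval (input_val n e) A) ` set (mcircuit_forms (D n))" using mem by blast
        show "triv_eval w ?J" if "\<And>a. a \<in> graph_atoms n \<Longrightarrow> v a \<Longrightarrow> w a" "triv_eval v ?J" for v w
          using at that pos by (intro triv_eval_mono[of ?J v w]) auto
      qed (use MDI_separates[OF assms(7) det J pos] in blast)+
      then show ?thesis by simp
    next
      assume det: "detects chain_eval"
      \<comment> \<open>The two functions per node cancel against the factor 1/2 of the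
        bound.\<close>
      have "2 powr (real n powr (1/3 - \<epsilon>) / 16) \<le> real (2 * length (D n)) / 2"
      proof (rule separating_function_large[where eva = "\<lambda>v. chain_eval v ?J",
            OF elim(1) mono_gates_mcircuit_chain[OF D(2)]])
        show "(\<lambda>e. chain_eval (input_val n e) ?J) \<in> (\<lambda>A e. ver_eval (input_val n e) A) ` set (mcircuit_forms (D n)) \<union> (\<lambda>A e. chain_eval (input_val n e) A) ` set (mcircuit_forms (D n))" using mem by blast
        show "chain_eval w ?J" if "\<And>a. a \<in> graph_atoms n \<Longrightarrow> v a \<Longrightarrow> w a" "chain_eval v ?J" for v w
          using at that pos by (intro chain_eval_mono[of ?J v w]) auto
      qed (use MDI_separates[OF assms(7) det J pos] in blast)+
      then show ?thesis by simp
    qed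
    then show ?case by (simp add: circuit_size_def)
  qed
  then show "\<exists>c>0. \<forall>\<^sub>F n in sequentially. 2 powr (c * real n powr (1/3 - \<epsilon>)) \<le> real (circuit_size (D n))"
    by (intro exI[of _ "1/16"]) simp
qed

end
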